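(* Let $\mathcal H$ be a real Hilbert space and let $A:\mathcal H\to 2^{\mathcal H}$ be a maximally monotone operator such that $S=A^{-1}(0)\neq\emptyset$. Let $s>0$, $\alpha>2$, and $\lambda_k=\left(1+\frac s2+\epsilon\right)\frac{2s}{\alpha^2}k^2$ for some $\epsilon>\frac{2+s}{\alpha-2}$ and all $k\ge1$. Let $(f_k)$ be a sequence in $\mathcal H$ with $\sum_k k\|f_k\|<+\infty$ and $\sum_k k^3\|f_k\|^2<+\infty$. Let $(x_k)$ be a sequence generated, from arbitrary $x_0,x_1\in\mathcal H$, by the algorithm: for all $k\ge1$, $$\left\{\begin{array}{rcl} y_k&=&x_k+\left(1-\frac{\alpha}{k}\right)(x_k-x_{k-1}),\\ x_{k+1}&=&\frac{\lambda_k}{\lambda_k+s}(y_k+sf_k)+\frac{s}{\lambda_k+s}J_{(\lambda_k+s)A}(y_k+sf_k).\end{array}\right.$$ Then: (i) the speed tends to zero; more precisely, $\|x_{k+1}-x_k\|=\mathcal O(\frac1k)$ and $\sum_k k\|x_k-x_{k-1}\|^2<+\infty$; (ii) the sequence $(x_k)$ converges weakly, as $k\to+\infty$, to some $\hat x\in S$; (iii) the sequence $(y_k)$ converges weakly, as $k\to+\infty$, to $\hat x$.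
   Context: $S=A^{-1}(0)=\{z\in\mathcal H:0\in Az\}$. For $\mu>0$, $J_{\mu A}=(I+\mu A)^{-1}$ denotes the resolvent of $A$ with index $\mu$ (single-valued and everywhere defined since $A$ is maximally monotone). *)

theory Defs
  imports "HOL-Analysis.Analysis" "HOL-Library.Landau_Symbols"
begin

text \<open>
  A real Hilbert space is a type of class \<open>{real_inner, complete_space}\<close>.  A set-valued operator
  \<open>A : H \<rightarrow> 2\<^sup>H\<close> is a function \<open>'a \<Rightarrow> 'a set\<close>; its graph is \<open>{(x, u). u \<in> A x}\<close>.
\<close>

definition monotone_operator :: "('a::real_inner \<Rightarrow> 'a set) \<Rightarrow> bool" where
  "monotone_operator A \<longleftrightarrow>
     (\<forall>x y. \<forall>u \<in> A x. \<forall>v \<in> A y. 0 \<le> (x - y) \<bullet> (u - v))"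

text \<open>Maximality is with respect to inclusion of graphs.\<close>

definition maximally_monotone :: "('a::real_inner \<Rightarrow> 'a set) \<Rightarrow> bool" where
  "maximally_monotone A \<longleftrightarrow>
     monotone_operator A \<and>
     (\<forall>B. monotone_operator B \<and> (\<forall>x. A x \<subseteq> B x) \<longrightarrow> B = A)"

definition inverse_operator :: "('a \<Rightarrow> 'b set) \<Rightarrow> 'b \<Rightarrow> 'a set" where
  "inverse_operator A u = {z. u \<in> A z}"

definition zeros :: "('a::real_inner \<Rightarrow> 'a set) \<Rightarrow> 'a set" where
  "zeros A = inverse_operator A 0"

definition id_plus_scaled :: "real \<Rightarrow> ('a::real_inner \<Rightarrow> 'a set) \<Rightarrow> 'a \<Rightarrow> 'a set" where
  "id_plus_scaled \<mu> A z = {z + \<mu> *\<^sub>R v | v. v \<in> A z}"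

text \<open>
  The resolvent \<open>(I + \<mu>A)\<^sup>-\<^sup>1\<close> as a point-valued map.  The description is meaningful when
  \<open>(I + \<mu>A)\<^sup>-\<^sup>1\<close> is single-valued and everywhere defined, which holds for \<open>\<mu> > 0\<close> and
  \<open>A\<close> maximally monotone on a Hilbert space (Minty).
\<close>

definition resolvent :: "real \<Rightarrow> ('a::real_inner \<Rightarrow> 'a set) \<Rightarrow> 'a \<Rightarrow> 'a" where
  "resolvent \<mu> A x = (THE z. z \<in> inverse_operator (id_plus_scaled \<mu> A) x)"

definition weakly_converges :: "(nat \<Rightarrow> 'a::real_inner) \<Rightarrow> 'a \<Rightarrow> bool" where
  "weakly_converges x l \<longleftrightarrow> (\<forall>w. (\<lambda>k. x k \<bullet> w) \<longlonglongrightarrow> l \<bullet> w)"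

end

theory Submission
  imports Defs
begin

text \<open>
  Let \<open>u k\<close> be the Yosida regularisation of \<open>A\<close> with parameter \<open>lam k\<close> at \<open>x (k + 1)\<close>.  The
  iteration is the implicit step \<open>x (k + 1) + s u k = y k + s f k\<close>, a discretisation of an inertial system with
  damping \<open>\<alpha> / t\<close>.  The regularisation is \<open>lam k\<close>-cocoercive, and since \<open>lam k\<close> grows like \<open>k\<^sup>2\<close> the
  resulting gain of order \<open>k\<^sup>2 \<parallel>u k\<parallel>\<^sup>2\<close> is just large enough to control the inertia.  For every zero
  \<open>z\<close> of \<open>A\<close>, the energy
  \<open>(k - 1) (h k - h (k - 1)) + (\<alpha> - 1) h (k - 1) + b \<alpha> / 2 (k - 1)\<^sup>2 \<parallel>x k - x (k - 1)\<parallel>\<^sup>2\<close>,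
  where \<open>h k = \<parallel>x k - z\<parallel>\<^sup>2 / 2\<close> and \<open>lam k = b s k\<^sup>2\<close>, is coercive and, up to
  summable perturbations, decreases by at least a positive multiple of
  \<open>k \<parallel>x k - x (k - 1)\<parallel>\<^sup>2 + k\<^sup>3 \<parallel>u k\<parallel>\<^sup>2\<close> (\<open>inertial_energy_coercive\<close>, \<open>inertial_energy_decrease\<close>).
  Boundedness of the energy gives the rate \<open>O(1 / k)\<close> for the velocity, and the decrements give the two
  summability statements (\<open>energy_estimates\<close>).

  Weak convergence follows from Opial's lemma.  The distances to zeros converge, because the positive
  parts of their increments are summable (\<open>convergent_distance\<close>).  Cluster points are zeros, because
  \<open>lam k u k\<close>, which separates \<open>x (k + 1)\<close> from a point of the graph, tends to zero in norm
  (\<open>yosida_tendsto_0\<close>, \<open>asymptotic_hull_subset_zeros\<close>).  Finally \<open>y k - x k\<close> tends to zero with the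
  velocity.

  Two facts of Hilbert space theory enter: Minty's theorem, which makes the resolvents
  meaningful, and the existence of weak cluster points.  Both are derived from one intersection
  property of nested closed convex sets (\<open>nested_closed_convex_common_point\<close>).  For the first, a
  strongly convex function built from the Fitzpatrick function of \<open>A\<close> is minimised; for the second,
  weak cluster points are replaced by points common to all closed convex hulls of tails.
\<close>

section \<open>Nested closed convex sets\<close>

text \<open>
  In a Hilbert space this intersection property takes over the role of weak compactness: it provides
  both the minimiser in Minty's theorem and the weak limit in Opial's lemma.  The squared distances
  \<open>d n\<close> of \<open>C n\<close> from the origin increase to a finite limit.  Almost nearest points \<open>v n \<in> C n\<close>
  form a Cauchy sequence, because by the parallelogram identity two of them that are far apart
  would have a midpoint closer to the origin than the convex set allows.
\<close>

lemma nested_closed_convex_common_point: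
  fixes C :: "nat \<Rightarrow> 'a::{real_inner, complete_space} set"
  assumes closed: "\<And>n. closed (C n)" and convex: "\<And>n. convex (C n)"
    and nonempty: "\<And>n. C n \<noteq> {}" and decseq: "decseq C" and bounded: "bounded (C 0)"
  shows "(\<Inter>n. C n) \<noteq> {}"
proof -
  define d where "d n = (INF v\<in>C n. (norm v)\<^sup>2)" for n
  have below: "bdd_below ((\<lambda>v. (norm v)\<^sup>2) ` C n)" for n
    by (rule bdd_belowI2[where m = 0]) simp
  have d_le: "d n \<le> (norm v)\<^sup>2" if "v \<in> C n" for n v
    unfolding d_def by (rule cINF_lower[OF below that])
  have "incseq d"
    unfolding d_def using decseq by (auto intro!: incseq_SucI cINF_superset_mono nonempty below simp: decseq_Suc_iff)
  obtain R where R: "\<And>v. v \<in> C 0 \<Longrightarrow> norm v \<le> R"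
    using bounded by (auto simp: bounded_iff)
  have "d n \<le> R\<^sup>2" for n
  proof -
    obtain v where "v \<in> C n" using nonempty by blast
    moreover from this have "v \<in> C 0" using decseq by (auto simp: decseq_def)
    ultimately show ?thesis
      using d_le[of v n] R[of v] power_mono[of "norm v" R 2] by fastforce
  qed
  with \<open>incseq d\<close> have "Cauchy d"
    using incseq_convergent[of d "R\<^sup>2"] convergent_Cauchy convergent_def by metis
  have "\<exists>v\<in>C n. (norm v)\<^sup>2 < d n + inverse (real (Suc n))" for n
  proof -
    have "Inf ((\<lambda>v. (norm v)\<^sup>2) ` C n) < d n + inverse (real (Suc n))"
      unfolding d_def by simp
    then show ?thesis
      using nonempty below by (subst (asm) cInf_less_iff) auto
  qed
  then obtain v where v: "\<And>n. v n \<in> C n" "\<And>n. (norm (v n))\<^sup>2 < d n + inverse (real (Suc n))"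
    by metis
  have close: "(dist (v m) (v n))\<^sup>2 \<le> 2 * \<bar>d m - d n\<bar> + 4 * inverse (real (Suc n))"
    if "n \<le> m" for m n
  proof -
    have "v m \<in> C n" using v(1) decseq that by (auto simp: decseq_def)
    then have "(1/2) *\<^sub>R v m + (1/2) *\<^sub>R v n \<in> C n"
      using v(1) convex by (intro convexD) auto
    from d_le[OF this] have mid: "d n \<le> (norm ((1/2) *\<^sub>R v m + (1/2) *\<^sub>R v n))\<^sup>2" .
    have "(dist (v m) (v n))\<^sup>2
        = 2 * (norm (v m))\<^sup>2 + 2 * (norm (v n))\<^sup>2 - 4 * (norm ((1/2) *\<^sub>R v m + (1/2) *\<^sub>R v n))\<^sup>2"
      by (simp add: dist_norm power2_norm_eq_inner inner_simps algebra_simps inner_commute)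
    with mid have 1: "(dist (v m) (v n))\<^sup>2 \<le> 2 * (norm (v m))\<^sup>2 + 2 * (norm (v n))\<^sup>2 - 4 * d n"
      by simp
    define i j where "i = inverse (real (Suc m))" and "j = inverse (real (Suc n))"
    have 2: "i \<le> j"
      using that by (simp add: i_def j_def field_simps)
    have 3: "(norm (v m))\<^sup>2 < d m + i" "(norm (v n))\<^sup>2 < d n + j"
      using v(2) by (auto simp: i_def j_def)
    have "(dist (v m) (v n))\<^sup>2 \<le> 2 * \<bar>d m - d n\<bar> + 4 * j"
      using 1 2 3 abs_ge_self[of "d m - d n"] by argo
    then show ?thesis by (simp add: j_def)
  qed
  have "Cauchy v"
  proof (rule metric_CauchyI)
    fix e :: real assume "e > 0"
    then have e2: "e\<^sup>2 / 8 > 0" by simp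
    obtain M1 where M1: "\<And>m n. m \<ge> M1 \<Longrightarrow> n \<ge> M1 \<Longrightarrow> \<bar>d m - d n\<bar> < e\<^sup>2 / 8"
      using metric_CauchyD[OF \<open>Cauchy d\<close> e2] by (auto simp: dist_real_def)
    obtain M2 where M2: "inverse (real (Suc M2)) < e\<^sup>2 / 8"
      using reals_Archimedean[OF e2] by blast
    have ordered: "dist (v m) (v n) < e" if "n \<ge> max M1 M2" "n \<le> m" for m n
    proof -
      have "inverse (real (Suc n)) \<le> inverse (real (Suc M2))"
        using that by (simp add: field_simps)
      moreover have "\<bar>d m - d n\<bar> < e\<^sup>2 / 8" using M1 that by simp
      ultimately have "(dist (v m) (v n))\<^sup>2 < e\<^sup>2"
        using close[OF that(2)] M2 by argo
      then show ?thesis using \<open>e > 0\<close> by (simp add: power2_less_imp_less)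
    qed
    show "\<exists>M. \<forall>m\<ge>M. \<forall>n\<ge>M. dist (v m) (v n) < e"
    proof (intro exI allI impI)
      fix m n assume "max M1 M2 \<le> m" "max M1 M2 \<le> n"
      then show "dist (v m) (v n) < e"
        using ordered[of n m] ordered[of m n] by (cases "n \<le> m") (auto simp: dist_commute)
    qed
  qed
  then obtain p where p: "v \<longlonglongrightarrow> p" by (auto simp: Cauchy_convergent_iff convergent_def)
  have "p \<in> C n" for n
  proof (rule Lim_in_closed_set[OF closed _ _ p])
    show "eventually (\<lambda>m. v m \<in> C n) sequentially"
      using v(1) decseq by (auto simp: decseq_def eventually_sequentially intro!: exI[of _ n])
  qed simp
  then show ?thesis by blast
qed

section \<open>Maximally monotone operators and their resolvents\<close>

text \<open>
  Maximality in its pointwise form: a pair that is monotonically related to the whole graph could be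
  added to the graph, so it already belongs to it.
\<close>

lemma maximally_monotone_iff:
  "maximally_monotone A \<longleftrightarrow> monotone_operator A \<and>
     (\<forall>x u. (\<forall>p. \<forall>q\<in>A p. 0 \<le> (x - p) \<bullet> (u - q)) \<longrightarrow> u \<in> A x)"
proof (intro iffI conjI)
  assume max: "maximally_monotone A"
  then show mono: "monotone_operator A" by (simp add: maximally_monotone_def)
  show "\<forall>x u. (\<forall>p. \<forall>q\<in>A p. 0 \<le> (x - p) \<bullet> (u - q)) \<longrightarrow> u \<in> A x"
  proof (intro allI impI)
    fix x u assume rel: "\<forall>p. \<forall>q\<in>A p. 0 \<le> (x - p) \<bullet> (u - q)"
    have rel': "0 \<le> (p - x) \<bullet> (q - u)" if "q \<in> A p" for p q
      using rel that by (metis inner_minus_left inner_minus_right minus_diff_eq minus_minus)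
    let ?B = "A(x := insert u (A x))"
    have "monotone_operator ?B"
      using mono rel rel' by (auto simp: monotone_operator_def)
    moreover have "\<forall>z. A z \<subseteq> ?B z" by auto
    ultimately have "?B = A" using max unfolding maximally_monotone_def by blast
    then show "u \<in> A x" by (metis fun_upd_same insertI1)
  qed
next
  assume A: "monotone_operator A \<and>
     (\<forall>x u. (\<forall>p. \<forall>q\<in>A p. 0 \<le> (x - p) \<bullet> (u - q)) \<longrightarrow> u \<in> A x)"
  have "B = A" if B: "monotone_operator B" "\<forall>x. A x \<subseteq> B x" for B
  proof (rule ext)
    fix x
    have "u \<in> A x" if "u \<in> B x" for u
      using A B that unfolding monotone_operator_def by blast
    then show "B x = A x" using B by blast
  qed
  then show "maximally_monotone A" using A by (auto simp: maximally_monotone_def)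
qed

text \<open>
  This is Minty's theorem, up to the affine change of the operator made in
  \<open>maximally_monotone_affine\<close>.  The set \<open>K\<close> is the epigraph of the Fitzpatrick function
  \<open>F (x, u) = (SUP (p, q) \<in> graph A. x \<bullet> q + p \<bullet> u - p \<bullet> q)\<close>.  Maximality gives \<open>x \<bullet> u \<le> F (x, u)\<close>,
  with equality on the graph, so the strongly convex function \<open>F (x, u) + (\<parallel>x\<parallel>\<^sup>2 + \<parallel>u\<parallel>\<^sup>2) / 2\<close> is
  nonnegative.  It attains its infimum at some \<open>(x, u)\<close>, a common point of its sublevel sets in \<open>K\<close>.
  First-order optimality, tested against points \<open>((p, q), p \<bullet> q)\<close> of \<open>K\<close> that come from the graph, yields
  \<open>(p + u) \<bullet> (q + x) \<ge> \<parallel>x + u\<parallel>\<^sup>2\<close>.  By maximality \<open>(- u, - x)\<close> is then in the graph, and taking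
  it for \<open>(p, q)\<close> forces \<open>x + u = 0\<close>.
\<close>

lemma id_plus_maximally_monotone_has_zero:
  fixes A :: "'a::{real_inner, complete_space} \<Rightarrow> 'a set"
  assumes "maximally_monotone A"
  shows "\<exists>x. - x \<in> A x"
proof -
  have mono: "0 \<le> (x - p) \<bullet> (u - q)" if "u \<in> A x" "q \<in> A p" for x u p q
    using assms that unfolding maximally_monotone_iff monotone_operator_def by blast
  have maxi: "u \<in> A x" if "\<And>p q. q \<in> A p \<Longrightarrow> 0 \<le> (x - p) \<bullet> (u - q)" for x u
    using assms that unfolding maximally_monotone_iff by blast
  obtain p1 q1 where pq1: "q1 \<in> A p1" using maxi by blast
  define K :: "(('a \<times> 'a) \<times> real) set"
    where "K = {w. \<forall>p q. q \<in> A p \<longrightarrow> fst w \<bullet> (q, p) - p \<bullet> q \<le> snd w}"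
  define \<phi> where "\<phi> w = snd w + (norm (fst w))\<^sup>2 / 2" for w :: "('a \<times> 'a) \<times> real"
  have K_ge: "x \<bullet> u \<le> t" if "((x, u), t) \<in> K" for x u t
  proof (rule ccontr)
    assume "\<not> x \<bullet> u \<le> t"
    then have less: "x \<bullet> q + u \<bullet> p - p \<bullet> q < x \<bullet> u" if "q \<in> A p" for p q
      using \<open>((x, u), t) \<in> K\<close> that by (force simp: K_def)
    have "u \<in> A x"
    proof (rule maxi)
      fix p q assume "q \<in> A p"
      then show "0 \<le> (x - p) \<bullet> (u - q)"
        using less[of q p] by (simp add: inner_diff_left inner_diff_right inner_commute)
    qed
    from less[OF this] show False by (simp add: inner_commute)
  qed
  have graph_in_K: "((p, q), p \<bullet> q) \<in> K" if "q \<in> A p" for p q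
  proof -
    have "p \<bullet> q' + q \<bullet> p' - p' \<bullet> q' \<le> p \<bullet> q" if "q' \<in> A p'" for p' q'
      using mono[OF \<open>q \<in> A p\<close> that]
      by (simp add: inner_diff_left inner_diff_right inner_commute[of q p'])
    then show ?thesis by (simp add: K_def)
  qed
  have \<phi>_lower: "0 \<le> \<phi> w" if "w \<in> K" for w
  proof -
    obtain x u t where w: "w = ((x, u), t)" by (metis prod.exhaust)
    have "\<phi> w - (norm (x + u))\<^sup>2 / 2 = t - x \<bullet> u"
      unfolding w \<phi>_def
      by (simp add: power2_norm_eq_inner inner_simps inner_commute[of u x] field_simps)
    then have "\<phi> w \<ge> (norm (x + u))\<^sup>2 / 2"
      using K_ge that w by force
    then show ?thesis by (smt (verit) zero_le_power2 divide_nonneg_pos)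
  qed
  have convexK: "convex K"
  proof (rule convexI)
    fix v w :: "('a \<times> 'a) \<times> real" and a b :: real
    assume "v \<in> K" "w \<in> K" and ab: "0 \<le> a" "0 \<le> b" "a + b = 1"
    have "fst (a *\<^sub>R v + b *\<^sub>R w) \<bullet> (q, p) - p \<bullet> q \<le> snd (a *\<^sub>R v + b *\<^sub>R w)" if "q \<in> A p" for p q
    proof -
      have "a * (fst v \<bullet> (q, p) - p \<bullet> q) + b * (fst w \<bullet> (q, p) - p \<bullet> q) \<le> a * snd v + b * snd w"
        using \<open>v \<in> K\<close> \<open>w \<in> K\<close> ab that
        by (intro add_mono mult_left_mono) (auto simp: K_def)
      moreover have "a * (fst v \<bullet> (q, p) - p \<bullet> q) + b * (fst w \<bullet> (q, p) - p \<bullet> q)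
          = fst (a *\<^sub>R v + b *\<^sub>R w) \<bullet> (q, p) - (a + b) * (p \<bullet> q)"
        by (simp only: fst_add fst_scaleR inner_add_left inner_scaleR_left) algebra
      ultimately show ?thesis using ab by simp
    qed
    then show "a *\<^sub>R v + b *\<^sub>R w \<in> K" by (auto simp: K_def)
  qed
  have closedK: "closed K"
  proof -
    have "K = (\<Inter>(p, q)\<in>{(p, q). q \<in> A p}. {w. fst w \<bullet> (q, p) - p \<bullet> q \<le> snd w})"
      by (auto simp: K_def)
    also have "closed \<dots>"
      by (auto intro!: closed_INT closed_Collect_le continuous_intros)
    finally show ?thesis .
  qed
  define m where "m = Inf (\<phi> ` K)"
  have bdd: "bdd_below (\<phi> ` K)" by (rule bdd_belowI2[OF \<phi>_lower])
  have K_ne: "K \<noteq> {}" using graph_in_K[OF pq1] by blast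
  define C where "C n = K \<inter> {w. \<phi> w \<le> m + inverse (real (Suc n))}" for n
  have convex_\<phi>: "convex {w. \<phi> w \<le> c}" for c
  proof (rule convexI)
    fix v w :: "('a \<times> 'a) \<times> real" and a b :: real
    assume vw: "v \<in> {w. \<phi> w \<le> c}" "w \<in> {w. \<phi> w \<le> c}" and ab: "0 \<le> a" "0 \<le> b" "a + b = 1"
    have b: "b = 1 - a" using ab by simp
    have "a * \<phi> v + b * \<phi> w - \<phi> (a *\<^sub>R v + b *\<^sub>R w) = a * b / 2 * (norm (fst v - fst w))\<^sup>2"
      unfolding \<phi>_def b power2_norm_eq_inner fst_add snd_add fst_scaleR snd_scaleR
      by (simp add: inner_add_left inner_add_right inner_diff_left inner_diff_right inner_commute[of "fst w" "fst v"] field_simps)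
    moreover have "0 \<le> a * b / 2 * (norm (fst v - fst w))\<^sup>2" using ab by simp
    moreover have "a * \<phi> v + b * \<phi> w \<le> a * c + b * c"
      using vw ab by (intro add_mono mult_left_mono) auto
    moreover have "a * c + b * c = c" using ab by (metis distrib_right mult_1)
    ultimately show "a *\<^sub>R v + b *\<^sub>R w \<in> {w. \<phi> w \<le> c}" by simp
  qed
  have "(\<Inter>n. C n) \<noteq> {}"
  proof (rule nested_closed_convex_common_point)
    show "closed (C n)" for n
      unfolding C_def \<phi>_def
      by (intro closed_Int closedK closed_Collect_le continuous_intros) auto
    show "convex (C n)" for n
      unfolding C_def by (intro convex_Int convexK convex_\<phi>)
    show "C n \<noteq> {}" for n
    proof -
      have "Inf (\<phi> ` K) < m + inverse (real (Suc n))" by (simp add: m_def)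
      then obtain w where "w \<in> K" "\<phi> w < m + inverse (real (Suc n))"
        using K_ne bdd by (subst (asm) cInf_less_iff) auto
      then show ?thesis by (auto simp: C_def less_imp_le)
    qed
    have "inverse (real (Suc n)) \<le> inverse (real (Suc k))" if "k \<le> n" for k n
      using that by (simp add: field_simps)
    then show "decseq C"
      unfolding decseq_def C_def by (auto intro: order_trans[OF _ add_left_mono])
    \<comment> \<open>On a sublevel set, the affine minorant of \<open>F\<close> given by the single pair \<open>(p1, q1)\<close> bounds
    \<open>snd w\<close> below by a linear function of \<open>norm (fst w)\<close>, while the quadratic term grows faster.\<close>
    show "bounded (C 0)"
    proof -
      let ?g = "(q1, p1)"
      have "m \<ge> 0" unfolding m_def using K_ne \<phi>_lower by (auto intro: cINF_greatest)
      define c where "c = 2 * (m + 1) + 2 * \<bar>p1 \<bullet> q1\<bar>"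
      define R where "R = 2 * norm ?g + c + 1"
      have "c \<ge> 0" using \<open>m \<ge> 0\<close> by (simp add: c_def)
      have "norm w \<le> R + (m + 1 + R * norm ?g + \<bar>p1 \<bullet> q1\<bar>)" if w: "w \<in> C 0" for w
      proof -
        let ?N = "norm (fst w)"
        have 1: "snd w + ?N\<^sup>2 / 2 \<le> m + 1"
          using w by (simp add: C_def \<phi>_def)
        have 2: "fst w \<bullet> ?g - p1 \<bullet> q1 \<le> snd w"
          using w pq1 unfolding C_def K_def by blast
        have 3: "- (?N * norm ?g) \<le> fst w \<bullet> ?g"
          using Cauchy_Schwarz_ineq2[of "fst w" ?g] by linarith
        have 4: "p1 \<bullet> q1 \<le> \<bar>p1 \<bullet> q1\<bar>" by simp
        have N: "?N \<le> R"
        proof (rule ccontr)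
          assume "\<not> ?N \<le> R"
          then have "?N > R" by simp
          moreover have "R \<ge> 1" using \<open>c \<ge> 0\<close> by (simp add: R_def)
          ultimately have "?N > 1" by simp
          have "?N * ?N \<le> 2 * (?N * norm ?g) + c"
            using 1 2 3 4 unfolding power2_eq_square c_def by argo
          also have "c \<le> c * ?N" using \<open>c \<ge> 0\<close> \<open>?N > 1\<close> by (simp add: mult_le_cancel_left1)
          finally have "?N * ?N \<le> (2 * norm ?g + c) * ?N" by (simp add: algebra_simps)
          then have "?N \<le> 2 * norm ?g + c"
            by (rule mult_right_le_imp_le) (use \<open>?N > 1\<close> in linarith)
          then show False using \<open>?N > R\<close> by (simp add: R_def)
        qed
        then have "?N * norm ?g \<le> R * norm ?g" by (intro mult_right_mono) auto
        moreover have "snd w \<le> m + 1" using 1 zero_le_power2[of ?N] by argo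
        moreover have "0 \<le> R * norm ?g" using \<open>c \<ge> 0\<close> by (simp add: R_def)
        ultimately have "\<bar>snd w\<bar> \<le> m + 1 + R * norm ?g + \<bar>p1 \<bullet> q1\<bar>"
          using 2 3 4 \<open>m \<ge> 0\<close> by (intro abs_leI) argo+
        moreover have "norm w \<le> ?N + \<bar>snd w\<bar>"
          using norm_Pair_le[of "fst w" "snd w"] by simp
        ultimately show ?thesis using N by argo
      qed
      then show ?thesis unfolding bounded_iff by blast
    qed
  qed
  then obtain w where w: "\<And>n. w \<in> C n" by blast
  obtain x u t where xut: "w = ((x, u), t)" by (metis prod.exhaust)
  have wK: "w \<in> K" using w by (auto simp: C_def)
  have "\<phi> w \<le> m"
  proof (rule field_le_epsilon)
    fix e :: real assume "e > 0"
    then obtain n where "inverse (real (Suc n)) < e" using reals_Archimedean by blast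
    then show "\<phi> w \<le> m + e" using w[of n] by (auto simp: C_def)
  qed
  then have min: "\<phi> w \<le> \<phi> v" if "v \<in> K" for v
    using \<open>\<phi> w \<le> m\<close> cINF_lower[OF bdd that] by (simp add: m_def)
  \<comment> \<open>The first-order optimality condition: otherwise moving from the minimiser towards \<open>v\<close>
  by a short step \<open>\<tau>\<close> would decrease \<open>\<phi>\<close>.\<close>
  have variational: "0 \<le> snd v - t + (x, u) \<bullet> (fst v - (x, u))" if v: "v \<in> K" for v
  proof (rule ccontr)
    define g where "g = snd v - t + (x, u) \<bullet> (fst v - (x, u))"
    define N where "N = (norm (fst v - (x, u)))\<^sup>2"
    assume "\<not> ?thesis"
    then have g: "g < 0" by (simp add: g_def)
    define \<tau> where "\<tau> = min 1 (- g / (N + 1))"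
    have N: "N \<ge> 0" by (simp add: N_def)
    have \<tau>: "0 < \<tau>" "\<tau> \<le> 1" using g N by (auto simp: \<tau>_def divide_neg_pos)
    have "(1 - \<tau>) *\<^sub>R w + \<tau> *\<^sub>R v \<in> K"
      using \<tau> wK v convexK by (intro convexD) auto
    then have "\<phi> w \<le> \<phi> ((1 - \<tau>) *\<^sub>R w + \<tau> *\<^sub>R v)" by (rule min)
    also have "\<dots> = \<phi> w + \<tau> * g + \<tau>\<^sup>2 * N / 2"
    proof -
      define e where "e = fst v - (x, u)"
      have "fst ((1 - \<tau>) *\<^sub>R w + \<tau> *\<^sub>R v) = (x, u) + \<tau> *\<^sub>R e"
        by (simp add: xut e_def algebra_simps)
      moreover have "snd ((1 - \<tau>) *\<^sub>R w + \<tau> *\<^sub>R v) = t + \<tau> * (snd v - t)"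
        by (simp add: xut algebra_simps)
      moreover have "(norm (z + \<tau> *\<^sub>R e))\<^sup>2 = (norm z)\<^sup>2 + 2 * \<tau> * (z \<bullet> e) + \<tau>\<^sup>2 * (norm e)\<^sup>2" for z
        unfolding power2_norm_eq_inner
        by (simp add: inner_add_left inner_add_right inner_commute power2_eq_square)
      ultimately show ?thesis
        unfolding \<phi>_def g_def N_def e_def[symmetric] xut fst_conv snd_conv
        by (simp add: field_simps)
    qed
    finally have "0 \<le> \<tau> * (g + \<tau> * N / 2)" by (simp add: power2_eq_square algebra_simps)
    then have "0 \<le> g + \<tau> * N / 2" using \<tau> by (simp add: zero_le_mult_iff)
    moreover have "\<tau> * N \<le> - g / (N + 1) * N" using N by (intro mult_right_mono) (auto simp: \<tau>_def)
    moreover have "- g / (N + 1) * N \<le> - g"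
      using N g by (simp add: field_simps)
    ultimately show False using g by linarith
  qed
  have key: "(x + u) \<bullet> (x + u) \<le> (p + u) \<bullet> (q + x)" if pq: "q \<in> A p" for p q
  proof -
    from variational[OF graph_in_K[OF pq]] have "t + x \<bullet> x + u \<bullet> u \<le> p \<bullet> q + x \<bullet> p + u \<bullet> q"
      by (simp add: inner_simps)
    moreover have "x \<bullet> u \<le> t" using K_ge wK xut by simp
    ultimately show ?thesis by (simp add: inner_simps inner_commute)
  qed
  have "- x \<in> A (- u)"
  proof (rule maxi)
    fix p q assume "q \<in> A p"
    from key[OF this] have "0 \<le> (p + u) \<bullet> (q + x)"
      using inner_ge_zero order_trans by blast
    then show "0 \<le> (- u - p) \<bullet> (- x - q)"
      by (simp add: inner_simps inner_commute)
  qed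
  from key[OF this] have "(x + u) \<bullet> (x + u) \<le> 0" by simp
  then have "x + u = 0" using inner_gt_zero_iff[of "x + u"] by linarith
  then have "- u = x" by (simp add: add_eq_0_iff2)
  with \<open>- x \<in> A (- u)\<close> show ?thesis by auto
qed

text \<open>
  With this operator in place of \<open>A\<close>, the inclusion \<open>- z \<in> A z\<close> turns into \<open>w \<in> z + \<mu> A z\<close>, the
  equation that defines the resolvent at \<open>w\<close>.
\<close>

lemma maximally_monotone_affine:
  assumes A: "maximally_monotone A" and "\<mu> > 0"
  shows "maximally_monotone (\<lambda>z. (\<lambda>v. \<mu> *\<^sub>R v - w) ` A z)"
  unfolding maximally_monotone_iff
proof (intro conjI allI impI)
  have scaled: "(x - p) \<bullet> ((\<mu> *\<^sub>R u - w) - (\<mu> *\<^sub>R q - w)) = \<mu> * ((x - p) \<bullet> (u - q))" for x p u q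
    by (simp add: inner_simps algebra_simps)
  show "monotone_operator (\<lambda>z. (\<lambda>v. \<mu> *\<^sub>R v - w) ` A z)"
    unfolding monotone_operator_def
  proof (intro allI ballI)
    fix x y u v
    assume "u \<in> (\<lambda>v. \<mu> *\<^sub>R v - w) ` A x" "v \<in> (\<lambda>v. \<mu> *\<^sub>R v - w) ` A y"
    then obtain u' v' where "u' \<in> A x" "v' \<in> A y" and uv: "u = \<mu> *\<^sub>R u' - w" "v = \<mu> *\<^sub>R v' - w"
      by blast
    then have "0 \<le> (x - y) \<bullet> (u' - v')"
      using A unfolding maximally_monotone_iff monotone_operator_def by blast
    then show "0 \<le> (x - y) \<bullet> (u - v)"
      unfolding uv scaled using \<open>\<mu> > 0\<close> by simp
  qed
  fix x u
  assume rel: "\<forall>p. \<forall>q\<in>(\<lambda>v. \<mu> *\<^sub>R v - w) ` A p. 0 \<le> (x - p) \<bullet> (u - q)"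
  define u' where "u' = (1 / \<mu>) *\<^sub>R (u + w)"
  have u: "u = \<mu> *\<^sub>R u' - w" using \<open>\<mu> > 0\<close> by (simp add: u'_def)
  have "0 \<le> (x - p) \<bullet> (u' - q)" if "q \<in> A p" for p q
  proof -
    have "0 \<le> (x - p) \<bullet> ((\<mu> *\<^sub>R u' - w) - (\<mu> *\<^sub>R q - w))" using rel that u by blast
    then show ?thesis using \<open>\<mu> > 0\<close> unfolding scaled by (simp add: zero_le_mult_iff)
  qed
  then have "u' \<in> A x" using A unfolding maximally_monotone_iff by blast
  then show "u \<in> (\<lambda>v. \<mu> *\<^sub>R v - w) ` A x" using u by blast
qed

text \<open>
  Existence is Minty's theorem; monotonicity makes the solution unique, so that the definite
  description in \<open>resolvent\<close> denotes it.  The element exhibited is the Yosida regularisation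
  \<open>A\<^sub>\<mu> w\<close>.
\<close>

lemma resolvent_inclusion:
  fixes A :: "'a::{real_inner, complete_space} \<Rightarrow> 'a set"
  assumes A: "maximally_monotone A" and "\<mu> > 0"
  shows "(1 / \<mu>) *\<^sub>R (w - resolvent \<mu> A w) \<in> A (resolvent \<mu> A w)"
proof -
  have iff: "z \<in> inverse_operator (id_plus_scaled \<mu> A) w \<longleftrightarrow> (1 / \<mu>) *\<^sub>R (w - z) \<in> A z" for z
    using \<open>\<mu> > 0\<close> by (force simp: inverse_operator_def id_plus_scaled_def)
  obtain z where "- z \<in> (\<lambda>v. \<mu> *\<^sub>R v - w) ` A z"
    using id_plus_maximally_monotone_has_zero[OF maximally_monotone_affine[OF assms]] by blast
  then obtain v where v: "v \<in> A z" "- z = \<mu> *\<^sub>R v - w" by blast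
  then have "\<mu> *\<^sub>R v = w - z" by (metis add_diff_cancel diff_conv_add_uminus uminus_add_conv_diff diff_add_cancel)
  then have "v = (1 / \<mu>) *\<^sub>R (w - z)"
    using \<open>\<mu> > 0\<close> by (metis divide_self_if less_irrefl scaleR_one scaleR_scaleR times_divide_eq_left mult_1)
  with v have z: "(1 / \<mu>) *\<^sub>R (w - z) \<in> A z" by simp
  have "z' = z" if z': "(1 / \<mu>) *\<^sub>R (w - z') \<in> A z'" for z'
  proof -
    have "0 \<le> (z' - z) \<bullet> ((1 / \<mu>) *\<^sub>R (w - z') - (1 / \<mu>) *\<^sub>R (w - z))"
      using A z z' unfolding maximally_monotone_iff monotone_operator_def by blast
    also have "\<dots> = - (1 / \<mu>) * ((z' - z) \<bullet> (z' - z))"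
      by (simp add: inner_simps algebra_simps)
    finally have "(z' - z) \<bullet> (z' - z) \<le> 0"
      using \<open>\<mu> > 0\<close> by (simp add: field_simps)
    then show ?thesis by (metis inner_gt_zero_iff not_less right_minus_eq)
  qed
  with z have "\<exists>!z. (1 / \<mu>) *\<^sub>R (w - z) \<in> A z" by blast
  from theI'[OF this] show ?thesis unfolding resolvent_def iff .
qed

section \<open>Asymptotic hulls and Opial's lemma\<close>

text \<open>
  A strongly closed substitute for the set of weak cluster points: it contains them all, it is
  nonempty for bounded sequences by \<open>nested_closed_convex_common_point\<close>, and every linear inequality
  that holds along the sequence in the limit holds on it.
\<close>

definition asymptotic_hull :: "(nat \<Rightarrow> 'a::real_normed_vector) \<Rightarrow> 'a set" where
  "asymptotic_hull x = (\<Inter>n. closure (convex hull (x ` {n..})))"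

lemma asymptotic_hull_nonempty:
  fixes x :: "nat \<Rightarrow> 'a::{real_inner, complete_space}"
  assumes "bounded (range x)"
  shows "asymptotic_hull x \<noteq> {}"
  unfolding asymptotic_hull_def
proof (rule nested_closed_convex_common_point)
  show "decseq (\<lambda>n. closure (convex hull (x ` {n..})))"
    by (auto simp: decseq_def intro!: closure_mono hull_mono)
  have "x ` {0..} = range x" by (simp add: atLeast_0)
  show "bounded (closure (convex hull (x ` {0..})))"
    using assms bounded_convex_hull unfolding \<open>x ` {0..} = range x\<close> by (intro bounded_closure) 
qed (auto intro: convex_closure)

lemma asymptotic_hull_inner_le:
  assumes p: "p \<in> asymptotic_hull x" and le: "\<forall>\<^sub>F k in sequentially. x k \<bullet> w \<le> g k"
    and g: "g \<longlonglongrightarrow> c"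
  shows "p \<bullet> w \<le> c"
proof (rule field_le_epsilon)
  fix e :: real assume "e > 0"
  have "\<forall>\<^sub>F k in sequentially. x k \<bullet> w \<le> c + e"
    using le order_tendstoD(2)[OF g less_add_same_cancel1[THEN iffD2, OF \<open>e > 0\<close>]]
    by eventually_elim auto
  then obtain n where "\<And>k. k \<ge> n \<Longrightarrow> x k \<bullet> w \<le> c + e"
    by (auto simp: eventually_sequentially)
  then have sub: "x ` {n..} \<subseteq> {v. w \<bullet> v \<le> c + e}" by (auto simp: inner_commute)
  have "closure (convex hull (x ` {n..})) \<subseteq> {v. w \<bullet> v \<le> c + e}"
    by (intro closure_minimal hull_minimal sub convex_halfspace_le closed_halfspace_le)
  then show "p \<bullet> w \<le> c + e" using p by (auto simp: asymptotic_hull_def inner_commute)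
qed

lemma asymptotic_hull_inner_lim:
  assumes p: "p \<in> asymptotic_hull x" and lim: "(\<lambda>k. x k \<bullet> w) \<longlonglongrightarrow> c"
  shows "p \<bullet> w = c"
proof (rule antisym)
  show "p \<bullet> w \<le> c" by (rule asymptotic_hull_inner_le[OF p _ lim]) simp
  have "p \<bullet> (- w) \<le> - c"
    by (rule asymptotic_hull_inner_le[OF p _ tendsto_minus[OF lim]]) simp
  then show "c \<le> p \<bullet> w" by simp
qed

text \<open>
  Fix \<open>p\<close> in the asymptotic hull of \<open>x\<close>, and let \<open>q\<close> lie in the hull of a subsequence.  Since the
  distances to \<open>p\<close> and \<open>q\<close> converge, so does \<open>x k \<bullet> (q - p)\<close>.  Linear functionals with a limit along a
  sequence are constant on its hull, so \<open>p \<bullet> (q - p) = q \<bullet> (q - p)\<close>, which means \<open>q = p\<close>.  A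
  subsequence along which \<open>x k \<bullet> w\<close> stays above \<open>p \<bullet> w + e\<close> would have a hull point other than \<open>p\<close>.
\<close>

lemma opial:
  fixes x :: "nat \<Rightarrow> 'a::{real_inner, complete_space}"
  assumes bounded: "bounded (range x)"
    and dist: "\<And>z. z \<in> S \<Longrightarrow> convergent (\<lambda>k. (norm (x k - z))\<^sup>2)"
    and hull: "\<And>r. strict_mono r \<Longrightarrow> asymptotic_hull (x \<circ> r) \<subseteq> S"
  shows "\<exists>p\<in>S. weakly_converges x p"
proof -
  obtain p where p: "p \<in> asymptotic_hull x" using asymptotic_hull_nonempty[OF bounded] by blast
  have "p \<in> S" using hull[of id] p by (auto simp: strict_mono_id)
  have unique: "q = p" if r: "strict_mono r" and q: "q \<in> asymptotic_hull (x \<circ> r)" for r q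
  proof -
    have "q \<in> S" using hull r q by blast
    obtain c1 c2 where c: "(\<lambda>k. (norm (x k - p))\<^sup>2) \<longlonglongrightarrow> c1" "(\<lambda>k. (norm (x k - q))\<^sup>2) \<longlonglongrightarrow> c2"
      using dist \<open>p \<in> S\<close> \<open>q \<in> S\<close> by (metis convergent_def)
    have eq: "x k \<bullet> (q - p) = ((norm (x k - p))\<^sup>2 - (norm (x k - q))\<^sup>2 - p \<bullet> p + q \<bullet> q) / 2" for k
      by (simp add: power2_norm_eq_inner inner_simps inner_commute algebra_simps)
    have lim: "(\<lambda>k. x k \<bullet> (q - p)) \<longlonglongrightarrow> (c1 - c2 - p \<bullet> p + q \<bullet> q) / 2"
      unfolding eq by (intro tendsto_intros c) simp
    have "p \<bullet> (q - p) = (c1 - c2 - p \<bullet> p + q \<bullet> q) / 2"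
      by (rule asymptotic_hull_inner_lim[OF p lim])
    moreover have "q \<bullet> (q - p) = (c1 - c2 - p \<bullet> p + q \<bullet> q) / 2"
      by (rule asymptotic_hull_inner_lim[OF q]) (use LIMSEQ_subseq_LIMSEQ[OF lim r] in \<open>simp add: o_def\<close>)
    ultimately have "(q - p) \<bullet> (q - p) = 0" by (simp add: inner_diff_left)
    then show ?thesis by simp
  qed
  have one_sided: "\<forall>\<^sub>F k in sequentially. x k \<bullet> w < p \<bullet> w + e" if "e > 0" for w e
  proof (rule ccontr)
    assume "\<not> ?thesis"
    then have "infinite {k. p \<bullet> w + e \<le> x k \<bullet> w}"
      by (auto simp: cofinite_eq_sequentially[symmetric] eventually_cofinite not_less)
    then obtain r :: "nat \<Rightarrow> nat" where r: "strict_mono r" "\<And>n. p \<bullet> w + e \<le> x (r n) \<bullet> w"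
      using infinite_enumerate by blast
    have "bounded (range (x \<circ> r))" using bounded by (rule bounded_subset) auto
    then obtain q where q: "q \<in> asymptotic_hull (x \<circ> r)" using asymptotic_hull_nonempty by blast
    have "q \<bullet> (- w) \<le> - (p \<bullet> w + e)"
    proof (rule asymptotic_hull_inner_le[OF q _ tendsto_const])
      show "\<forall>\<^sub>F k in sequentially. (x \<circ> r) k \<bullet> (- w) \<le> - (p \<bullet> w + e)"
        using r(2) by (intro always_eventually allI) (simp del: minus_add_distrib)
    qed
    then show False using unique[OF r(1) q] \<open>e > 0\<close> by simp
  qed
  have "(\<lambda>k. x k \<bullet> w) \<longlonglongrightarrow> p \<bullet> w" for w
  proof (rule tendstoI)
    fix e :: real assume "e > 0"
    from one_sided[OF this, of w] one_sided[OF this, of "- w"]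
    show "\<forall>\<^sub>F k in sequentially. dist (x k \<bullet> w) (p \<bullet> w) < e"
      by eventually_elim (auto simp: dist_real_def)
  qed
  with \<open>p \<in> S\<close> show ?thesis by (auto simp: weakly_converges_def)
qed

section \<open>Real sequences\<close>

text \<open>
  The deterministic form of the Robbins-Siegmund lemma.  The factors \<open>1 + p j \<le> exp (p j)\<close> accumulate to
  at most \<open>exp (\<Sum>j. p j)\<close>, and the decrements \<open>r j\<close> can be carried along with \<open>V\<close>.
\<close>

lemma discrete_gronwall:
  fixes V p q r :: "nat \<Rightarrow> real"
  assumes step: "\<And>n. V (Suc n) \<le> (1 + p n) * V n + q n - r n"
    and V: "\<And>n. 0 \<le> V n" and p: "\<And>n. 0 \<le> p n" and q: "\<And>n. 0 \<le> q n" and r: "\<And>n. 0 \<le> r n"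
    and sp: "summable p" and sq: "summable q"
  shows "\<exists>M. \<forall>n. V n \<le> M" and "summable r"
proof -
  have main: "V n + (\<Sum>j<n. r j) \<le> exp (\<Sum>j<n. p j) * (V 0 + (\<Sum>j<n. q j))" for n
  proof (induction n)
    case (Suc n)
    let ?R = "\<Sum>j<n. r j" and ?P = "\<Sum>j<n. p j" and ?Q = "\<Sum>j<n. q j"
    have "?R \<ge> 0" "?P \<ge> 0" "?Q \<ge> 0" using p q r by (auto intro: sum_nonneg)
    have "V (Suc n) + (\<Sum>j<Suc n. r j) \<le> (1 + p n) * (V n + ?R) + q n"
      using step[of n] p[of n] mult_nonneg_nonneg[OF p[of n] \<open>?R \<ge> 0\<close>] by (simp add: algebra_simps)
    also have "\<dots> \<le> exp (p n) * (exp ?P * (V 0 + ?Q)) + exp (?P + p n) * q n"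
    proof (intro add_mono mult_mono Suc.IH)
      show "1 + p n \<le> exp (p n)" by (rule exp_ge_add_one_self)
      have "1 \<le> exp (?P + p n)" using p \<open>?P \<ge> 0\<close> by simp
      then show "q n \<le> exp (?P + p n) * q n"
        using q mult_right_mono[of 1 "exp (?P + p n)" "q n"] by simp
    qed (use V \<open>?R \<ge> 0\<close> in auto)
    also have "\<dots> = exp (\<Sum>j<Suc n. p j) * (V 0 + (\<Sum>j<Suc n. q j))"
      by (simp add: exp_add algebra_simps)
    finally show ?case .
  qed simp
  define M where "M = exp (suminf p) * (V 0 + suminf q)"
  have bound: "V n + (\<Sum>j<n. r j) \<le> M" for n
  proof -
    have "(\<Sum>j<n. p j) \<le> suminf p" "(\<Sum>j<n. q j) \<le> suminf q"
      using p q sp sq by (auto intro!: sum_le_suminf)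
    then have "exp (\<Sum>j<n. p j) * (V 0 + (\<Sum>j<n. q j)) \<le> M"
      unfolding M_def using V q by (intro mult_mono add_mono) (auto intro!: add_nonneg_nonneg sum_nonneg)
    with main[of n] show ?thesis by linarith
  qed
  have "0 \<le> (\<Sum>j<n. r j)" for n using r by (simp add: sum_nonneg)
  then have "V n \<le> M" for n using bound[of n] by (smt (verit))
  then show "\<exists>M. \<forall>n. V n \<le> M" by blast
  have "(\<Sum>j<n. r j) \<le> M" for n using bound[of n] V[of n] by linarith
  then show "summable r" using r by (intro summableI_nonneg_bounded) auto
qed

lemma convergent_of_summable_increments:
  fixes h :: "nat \<Rightarrow> real"
  assumes nonneg: "\<And>n. 0 \<le> h n" and inc: "summable (\<lambda>n. max 0 (h (Suc n) - h n))"
  shows "convergent h"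
proof -
  let ?S = "\<lambda>n. \<Sum>j<n. max 0 (h (Suc j) - h j)"
  have "convergent ?S" using inc by (simp add: summable_iff_convergent)
  have dec: "decseq (\<lambda>n. h n - ?S n)" by (intro decseq_SucI) simp
  have "- suminf (\<lambda>n. max 0 (h (Suc n) - h n)) \<le> h n - ?S n" for n
    using sum_le_suminf[OF inc, of "{..<n}"] nonneg[of n] by simp
  then obtain L where "(\<lambda>n. h n - ?S n) \<longlonglongrightarrow> L" using decseq_convergent[OF dec] by blast
  then have "convergent (\<lambda>n. h n - ?S n)" by (rule convergentI)
  from convergent_add[OF this \<open>convergent ?S\<close>] show ?thesis by simp
qed

text \<open>
  The squares \<open>(a n)\<^sup>2\<close> have summable increments, since these are bounded by
  \<open>M / Suc n * (a (Suc n) + a n)\<close>.  Hence \<open>a\<close> converges, and divergence of the harmonic series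
  excludes a positive limit.  In logarithmic time this says that an integrable Lipschitz function
  vanishes at infinity.
\<close>

lemma slowly_varying_tendsto_0:
  fixes a :: "nat \<Rightarrow> real"
  assumes nonneg: "\<And>n. 0 \<le> a n"
    and slow: "\<And>n. \<bar>a (Suc n) - a n\<bar> \<le> M / real (Suc n)"
    and summ: "summable (\<lambda>n. a n / real (Suc n))"
  shows "a \<longlonglongrightarrow> 0"
proof -
  have "M \<ge> 0" using slow[of 0] by simp
  let ?b = "\<lambda>n. M * (2 * (a (Suc n) / real (Suc (Suc n))) + a n / real (Suc n))"
  have "summable (\<lambda>n. a (Suc n) / real (Suc (Suc n)))"
    using summ by (subst summable_Suc_iff[where f = "\<lambda>n. a n / real (Suc n)"])
  then have "summable ?b"
    using summ by (intro summable_mult summable_add)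
  moreover have "norm ((a (Suc n))\<^sup>2 - (a n)\<^sup>2) \<le> ?b n" for n
  proof -
    have "norm ((a (Suc n))\<^sup>2 - (a n)\<^sup>2) = \<bar>a (Suc n) - a n\<bar> * (a (Suc n) + a n)"
      unfolding power2_eq_square square_diff_square_factored real_norm_def abs_mult
      using nonneg by (simp add: mult.commute)
    also have "\<dots> \<le> M / real (Suc n) * (a (Suc n) + a n)"
      using nonneg by (intro mult_right_mono slow) simp
    also have "\<dots> = M * (a (Suc n) / real (Suc n) + a n / real (Suc n))"
      by (simp add: add_divide_distrib[symmetric])
    also have "\<dots> \<le> ?b n"
    proof (intro mult_left_mono add_right_mono \<open>M \<ge> 0\<close>)
      have "1 / real (Suc n) \<le> 2 / real (Suc (Suc n))" by (simp add: field_simps)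
      from mult_left_mono[OF this nonneg[of "Suc n"]]
      show "a (Suc n) / real (Suc n) \<le> 2 * (a (Suc n) / real (Suc (Suc n)))"
        by (simp add: mult.commute)
    qed
    finally show ?thesis .
  qed
  ultimately have "summable (\<lambda>n. (a (Suc n))\<^sup>2 - (a n)\<^sup>2)"
    by (rule summable_comparison_test'[where N = 0]) 
  then have "convergent (\<lambda>n. (\<Sum>j<n. (a (Suc j))\<^sup>2 - (a j)\<^sup>2))"
    by (simp add: summable_iff_convergent)
  then have "convergent (\<lambda>n. (a n)\<^sup>2 - (a 0)\<^sup>2)"
    by (simp add: sum_lessThan_telescope[where f = "\<lambda>j. (a j)\<^sup>2"])
  then have "convergent (\<lambda>n. ((a n)\<^sup>2 - (a 0)\<^sup>2) + (a 0)\<^sup>2)"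
    by (rule convergent_add) (rule convergent_const)
  then obtain L where "(\<lambda>n. (a n)\<^sup>2) \<longlonglongrightarrow> L" by (auto simp: convergent_def)
  from tendsto_real_sqrt[OF this] have lim: "a \<longlonglongrightarrow> sqrt L" using nonneg by simp
  have "sqrt L = 0"
  proof (rule ccontr)
    assume "sqrt L \<noteq> 0"
    moreover have "0 \<le> sqrt L" by (rule LIMSEQ_le_const[OF lim]) (use nonneg in auto)
    ultimately have l: "0 < sqrt L" by simp
    then have "\<forall>\<^sub>F n in sequentially. sqrt L / 2 < a n" by (intro order_tendstoD(1)[OF lim]) simp
    then have "\<forall>\<^sub>F n in sequentially. norm (1 / real (Suc n)) \<le> 2 / sqrt L * (a n / real (Suc n))"
    proof eventually_elim
      case (elim n)
      then have "1 \<le> 2 / sqrt L * a n" using l by (simp add: field_simps)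
      then have "1 / real (Suc n) \<le> 2 / sqrt L * a n / real (Suc n)"
        by (rule divide_right_mono) simp
      then show ?case by simp
    qed
    then have "summable (\<lambda>n. 1 / real (Suc n))"
      by (rule summable_comparison_test_ev[OF _ summable_mult[OF summ]])
    then have "summable (\<lambda>n. inverse (real (Suc n)))" by (simp add: inverse_eq_divide)
    then show False using not_summable_harmonic[where 'a = real] summable_Suc_iff[of "\<lambda>n. inverse (real n)"] by simp
  qed
  with lim show ?thesis by simp
qed

section \<open>The energy of one inertial step\<close>

lemma norm_extrapolation:
  fixes p q z :: "'a::real_inner"
  shows "(norm (q + a *\<^sub>R (q - p) - z))\<^sup>2
    = (norm (q - z))\<^sup>2 + a * ((norm (q - z))\<^sup>2 - (norm (p - z))\<^sup>2) + a * (1 + a) * (norm (q - p))\<^sup>2"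
  unfolding power2_norm_eq_inner by (simp add: inner_simps inner_commute algebra_simps)

text \<open>
  The Lyapunov function, with \<open>p\<close> and \<open>q\<close> for two consecutive iterates \<open>x (k - 1)\<close> and \<open>x k\<close>, with
  \<open>\<kappa> = k - 1\<close>, and with \<open>b\<close> scaling the regularisation parameters as \<open>b s k\<^sup>2\<close>.  The first two terms
  come from summing \<open>k (h (k + 1) - h k) - (k - \<alpha>) (h k - h (k - 1))\<close> by parts, where
  \<open>h k = \<parallel>x k - z\<parallel>\<^sup>2 / 2\<close>; the last one is the kinetic energy that the cocoercivity term releases.
\<close>

definition inertial_energy :: "real \<Rightarrow> real \<Rightarrow> 'a::real_inner \<Rightarrow> real \<Rightarrow> 'a \<Rightarrow> 'a \<Rightarrow> real" where
  "inertial_energy b \<alpha> z \<kappa> p q =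
     \<kappa> * ((norm (q - z))\<^sup>2 / 2 - (norm (p - z))\<^sup>2 / 2) + (\<alpha> - 1) * ((norm (p - z))\<^sup>2 / 2)
     + b * \<alpha> / 2 * \<kappa>\<^sup>2 * (norm (q - p))\<^sup>2"

text \<open>
  The first term of the energy may be negative, but it is at least
  \<open>- \<kappa> \<parallel>q - p\<parallel> \<parallel>p - z\<parallel>\<close>, and Young's inequality absorbs this into half of the second term and the
  fraction \<open>1 / (\<alpha> - 1)\<close> of \<open>\<kappa>\<^sup>2 \<parallel>q - p\<parallel>\<^sup>2\<close>.
\<close>

lemma inertial_energy_coercive:
  fixes p q z :: "'a::real_inner"
  assumes "\<alpha> > 1" "\<kappa> \<ge> 0"
  shows "(\<alpha> - 1) / 4 * (norm (p - z))\<^sup>2 + (b * \<alpha> / 2 - 1 / (\<alpha> - 1)) * (\<kappa>\<^sup>2 * (norm (q - p))\<^sup>2)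
    \<le> inertial_energy b \<alpha> z \<kappa> p q"
proof -
  let ?X = "norm (p - z)" and ?D = "\<kappa> * norm (q - p)"
  have "(norm (q - z))\<^sup>2 = (norm (p - z))\<^sup>2 + 2 * ((q - p) \<bullet> (p - z)) + (norm (q - p))\<^sup>2"
    unfolding power2_norm_eq_inner by (simp add: inner_simps inner_commute algebra_simps)
  moreover have "- (norm (q - p) * norm (p - z)) \<le> (q - p) \<bullet> (p - z)"
    using Cauchy_Schwarz_ineq2[of "q - p" "p - z"] by linarith
  ultimately have "- (norm (q - p) * norm (p - z)) \<le> (norm (q - z))\<^sup>2 / 2 - (norm (p - z))\<^sup>2 / 2"
    by (smt (verit) zero_le_power2 field_sum_of_halves)
  from mult_left_mono[OF this \<open>\<kappa> \<ge> 0\<close>]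
  have 1: "- (?D * ?X) \<le> \<kappa> * ((norm (q - z))\<^sup>2 / 2 - (norm (p - z))\<^sup>2 / 2)"
    by (simp add: algebra_simps)
  have "0 \<le> ((\<alpha> - 1) * ?X - 2 * ?D)\<^sup>2 / (4 * (\<alpha> - 1))" using \<open>\<alpha> > 1\<close> by simp
  also have "\<dots> = (\<alpha> - 1) / 4 * ?X\<^sup>2 + 1 / (\<alpha> - 1) * ?D\<^sup>2 - ?D * ?X"
    using \<open>\<alpha> > 1\<close> by (simp add: power2_diff power_mult_distrib field_simps power2_eq_square)
  finally have 2: "?D * ?X \<le> (\<alpha> - 1) / 4 * ?X\<^sup>2 + 1 / (\<alpha> - 1) * ?D\<^sup>2" by simp
  have "?D\<^sup>2 = \<kappa>\<^sup>2 * (norm (q - p))\<^sup>2" by (rule power_mult_distrib)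
  with 1 2 show ?thesis unfolding inertial_energy_def by (simp add: algebra_simps)
qed

text \<open>
  The point \<open>x2\<close> solves \<open>x2 + s u = y + s f\<close>; both sides are measured from \<open>z\<close>, and the cross term
  on the left is controlled by the \<open>\<gamma>\<close>-cocoercivity of the Yosida regularisation.
\<close>

lemma cocoercive_step:
  fixes y f u z x2 :: "'a::real_inner"
  assumes x2: "x2 = y + s *\<^sub>R f - s *\<^sub>R u" and "s \<ge> 0"
    and coco: "\<gamma> * (norm u)\<^sup>2 \<le> u \<bullet> (x2 - z)"
  shows "(norm (x2 - z))\<^sup>2 \<le> (norm (y - z))\<^sup>2 + 2 * s * (f \<bullet> (y - z)) + (norm (s *\<^sub>R f))\<^sup>2
    - 2 * s * \<gamma> * (norm u)\<^sup>2"
proof -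
  have "(norm (y - z + s *\<^sub>R f))\<^sup>2 = (norm (y - z))\<^sup>2 + 2 * s * (f \<bullet> (y - z)) + (norm (s *\<^sub>R f))\<^sup>2"
    unfolding power2_norm_eq_inner
    by (simp only: inner_add_left inner_add_right inner_scaleR_left inner_scaleR_right
        inner_commute[of "y - z" f]) (simp add: algebra_simps)
  moreover have "(norm (y - z + s *\<^sub>R f))\<^sup>2 = (norm (x2 - z))\<^sup>2 + 2 * s * (u \<bullet> (x2 - z)) + (norm (s *\<^sub>R u))\<^sup>2"
  proof -
    have "y - z + s *\<^sub>R f = (x2 - z) + s *\<^sub>R u" by (simp add: x2)
    then show ?thesis
      unfolding power2_norm_eq_inner
      by (simp only: inner_add_left inner_add_right inner_scaleR_left inner_scaleR_right
          inner_commute[of "x2 - z" u]) (simp add: algebra_simps)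
  qed
  moreover have "2 * s * (\<gamma> * (norm u)\<^sup>2) \<le> 2 * s * (u \<bullet> (x2 - z))"
    using \<open>s \<ge> 0\<close> by (intro mult_left_mono coco) auto
  moreover have "2 * s * (\<gamma> * (norm u)\<^sup>2) = 2 * s * \<gamma> * (norm u)\<^sup>2" by simp
  ultimately show ?thesis using zero_le_power2[of "norm (s *\<^sub>R u)"] by argo
qed

text \<open>
  The gain \<open>b \<kappa>\<^sup>2 \<parallel>s u\<parallel>\<^sup>2\<close> from cocoercivity pays for everything.  A third of it is kept.  The rest
  dominates half of \<open>b \<kappa>\<^sup>2 D\<close>, where \<open>D = \<parallel>a d1 - d2\<parallel>\<^sup>2\<close> and \<open>s u = a d1 - d2 + s f\<close>, at the cost of a
  multiple of \<open>\<parallel>s f\<parallel>\<^sup>2\<close>.  Expanding \<open>D\<close> around \<open>d1\<close> produces the increment \<open>\<alpha> / \<kappa> (\<delta>2 - \<delta>1)\<close>, which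
  telescopes into the kinetic term of the energy, and \<open>\<alpha>\<^sup>2 / \<kappa>\<^sup>2 \<delta>1\<close>.  Counted together, the terms in
  \<open>\<kappa> \<delta>1\<close> have the coefficient \<open>1 - b \<alpha> (\<alpha> - 2) / 2\<close>, which is at most \<open>- s / 2\<close>.
\<close>

lemma inertial_energy_decrease:
  fixes x0 x1 x2 y f u z :: "'a::real_inner"
  assumes \<alpha>: "\<alpha> > 2" and \<kappa>: "\<kappa> \<ge> \<alpha>" and s: "s > 0" and b: "b \<ge> 0" "2 + s \<le> b * \<alpha> * (\<alpha> - 2)"
    and y: "y = x1 + (1 - \<alpha> / \<kappa>) *\<^sub>R (x1 - x0)"
    and x2: "x2 = y + s *\<^sub>R f - s *\<^sub>R u"
    and coco: "(b * s * \<kappa>\<^sup>2) * (norm u)\<^sup>2 \<le> u \<bullet> (x2 - z)"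
  shows "inertial_energy b \<alpha> z \<kappa> x1 x2 \<le> inertial_energy b \<alpha> z (\<kappa> - 1) x0 x1
     - (s / 2) * (\<kappa> * (norm (x1 - x0))\<^sup>2) - (b / 3) * (\<kappa> ^ 3 * (norm (s *\<^sub>R u))\<^sup>2)
     + s * \<kappa> * (f \<bullet> (y - z)) + (2 * b * \<kappa> ^ 3 + \<kappa> / 2) * (norm (s *\<^sub>R f))\<^sup>2"
proof -
  define a where "a = 1 - \<alpha> / \<kappa>"
  have "\<kappa> > 0" using \<alpha> \<kappa> by simp
  have a: "0 \<le> a" "a \<le> 1" using \<alpha> \<kappa> by (auto simp: a_def field_simps)
  have \<kappa>a: "\<kappa> * a = \<kappa> - \<alpha>" using \<open>\<kappa> > 0\<close> by (simp add: a_def field_simps)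
  define d1 where "d1 = x1 - x0"
  define d2 where "d2 = x2 - x1"
  define h0 where "h0 = (norm (x0 - z))\<^sup>2"
  define h1 where "h1 = (norm (x1 - z))\<^sup>2"
  define h2 where "h2 = (norm (x2 - z))\<^sup>2"
  define \<delta>1 where "\<delta>1 = (norm d1)\<^sup>2"
  define \<delta>2 where "\<delta>2 = (norm d2)\<^sup>2"
  define F where "F = f \<bullet> (y - z)"
  define U where "U = (norm (s *\<^sub>R u))\<^sup>2"
  define G where "G = (norm (s *\<^sub>R f))\<^sup>2"
  define D where "D = (norm (a *\<^sub>R d1 - d2))\<^sup>2"
  have "h2 \<le> h1 + a * (h1 - h0) + a * (1 + a) * \<delta>1 + 2 * s * F + G - 2 * s * (b * s * \<kappa>\<^sup>2) * (norm u)\<^sup>2"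
    using cocoercive_step[OF x2 _ coco] norm_extrapolation[of x1 a x0 z] s
    unfolding h0_def h1_def h2_def \<delta>1_def d1_def F_def G_def y a_def by simp
  also have "2 * s * (b * s * \<kappa>\<^sup>2) * (norm u)\<^sup>2 = 2 * b * \<kappa>\<^sup>2 * U"
    by (simp add: U_def power_mult_distrib power2_eq_square)
  also have "a * (1 + a) * \<delta>1 \<le> 2 * \<delta>1"
  proof -
    have "a * (1 + a) \<le> 1 * 2" using a by (intro mult_mono) auto
    then show ?thesis by (intro mult_right_mono) (auto simp: \<delta>1_def)
  qed
  finally have "h2 - h1 - a * (h1 - h0) \<le> 2 * \<delta>1 + 2 * s * F + G - 2 * b * \<kappa>\<^sup>2 * U" by simp
  from mult_left_mono[OF this, of "\<kappa> / 2"] \<open>\<kappa> > 0\<close>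
  have 1: "\<kappa> * (h2 - h1) / 2 - (\<kappa> * a) * (h1 - h0) / 2 \<le> \<kappa> * \<delta>1 + s * \<kappa> * F + \<kappa> / 2 * G - b * \<kappa> ^ 3 * U"
    by (simp add: field_simps power2_eq_square power3_eq_cube)
  have "s *\<^sub>R u = (a *\<^sub>R d1 - d2) + s *\<^sub>R f" by (simp add: x2 y d1_def d2_def a_def algebra_simps)
  \<comment> \<open>This combination of \<open>U = \<parallel>g + e\<parallel>\<^sup>2\<close>, \<open>D = \<parallel>g\<parallel>\<^sup>2\<close> and \<open>G = \<parallel>e\<parallel>\<^sup>2\<close> is chosen to be a perfect
  square, so that the splitting of \<open>U\<close> below loses only a multiple of \<open>G\<close>.\<close>
  then have "2 / 3 * U - D / 2 + 2 * G = (norm ((a *\<^sub>R d1 - d2) + 4 *\<^sub>R (s *\<^sub>R f)))\<^sup>2 / 6"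
    unfolding U_def D_def G_def power2_norm_eq_inner
    by (simp only: inner_add_left inner_add_right inner_scaleR_left inner_scaleR_right
        inner_commute[of f "a *\<^sub>R d1 - d2"]) (simp add: field_simps)
  moreover have "0 \<le> (norm ((a *\<^sub>R d1 - d2) + 4 *\<^sub>R (s *\<^sub>R f)))\<^sup>2 / 6" by simp
  ultimately have 2: "U / 3 + D / 2 - 2 * G \<le> U" by argo
  have "D = a * (norm (d2 - d1))\<^sup>2 + (1 - a) * (\<delta>2 - \<delta>1) + (1 - a)\<^sup>2 * \<delta>1"
    unfolding D_def \<delta>1_def \<delta>2_def power2_norm_eq_inner
    by (simp add: inner_simps inner_commute algebra_simps power2_eq_square)
  then have "(1 - a) * (\<delta>2 - \<delta>1) + (1 - a)\<^sup>2 * \<delta>1 \<le> D" using a by simp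
  from mult_left_mono[OF this, of "\<kappa>\<^sup>2"]
  have "\<kappa> * (\<kappa> * (1 - a)) * (\<delta>2 - \<delta>1) + (\<kappa> * (1 - a))\<^sup>2 * \<delta>1 \<le> \<kappa>\<^sup>2 * D"
    by (simp add: algebra_simps power2_eq_square)
  also have "\<kappa> * (1 - a) = \<alpha>" using \<kappa>a by (simp add: algebra_simps)
  finally have 3: "\<kappa> * \<alpha> * (\<delta>2 - \<delta>1) + \<alpha>\<^sup>2 * \<delta>1 \<le> \<kappa>\<^sup>2 * D" .
  have scaled2: "b * \<kappa> ^ 3 * (U / 3 + D / 2 - 2 * G) \<le> b * \<kappa> ^ 3 * U"
    using b \<open>\<kappa> > 0\<close> by (intro mult_left_mono[OF 2]) auto
  have scaled3: "b * \<kappa> / 2 * (\<kappa> * \<alpha> * (\<delta>2 - \<delta>1) + \<alpha>\<^sup>2 * \<delta>1) \<le> b * \<kappa> / 2 * (\<kappa>\<^sup>2 * D)"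
    using b \<open>\<kappa> > 0\<close> by (intro mult_left_mono[OF 3]) auto
  have 4: "(2 + s) * (\<kappa> * \<delta>1) \<le> b * \<alpha> * (\<alpha> - 2) * (\<kappa> * \<delta>1)"
    using \<open>\<kappa> > 0\<close> by (intro mult_right_mono b) (auto simp: \<delta>1_def)
  have 5: "0 \<le> b * \<alpha> * \<delta>1" using b \<alpha> by (simp add: \<delta>1_def)
  have "inertial_energy b \<alpha> z \<kappa> x1 x2 - inertial_energy b \<alpha> z (\<kappa> - 1) x0 x1
     = (\<kappa> * (h2 - h1) / 2 - (\<kappa> - \<alpha>) * (h1 - h0) / 2)
       + b * \<alpha> / 2 * (\<kappa>\<^sup>2 * (\<delta>2 - \<delta>1) + 2 * \<kappa> * \<delta>1 - \<delta>1)"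
    unfolding inertial_energy_def h0_def[symmetric] h1_def[symmetric] h2_def[symmetric]
      d1_def[symmetric] d2_def[symmetric] \<delta>1_def[symmetric] \<delta>2_def[symmetric]
    by (simp add: field_simps power2_eq_square)
  also have "\<dots> \<le> - (s / 2) * (\<kappa> * \<delta>1) - (b / 3) * (\<kappa> ^ 3 * U)
     + s * \<kappa> * F + (2 * b * \<kappa> ^ 3 + \<kappa> / 2) * G"
    using 1 scaled2 scaled3 4 5 unfolding \<kappa>a by (simp add: field_simps power2_eq_square power3_eq_cube)
  finally show ?thesis unfolding d1_def \<delta>1_def U_def F_def G_def by simp
qed

text \<open>
  A Lipschitz estimate for \<open>\<gamma> A\<^sub>\<gamma> \<xi>\<close> in the point \<open>\<xi>\<close> and in the relative change of \<open>\<gamma>\<close>, where \<open>u = A\<^sub>\<gamma> \<xi>\<close> means that \<open>u\<close> lies in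
  \<open>A (\<xi> - \<gamma> u)\<close>.  Monotonicity at the two resolvent points gives a quadratic inequality for the norm of
  the difference \<open>w\<close>.
\<close>

lemma yosida_difference:
  fixes \<xi> \<xi>' u u' :: "'a::real_inner"
  assumes mono: "0 \<le> ((\<xi> - \<gamma> *\<^sub>R u) - (\<xi>' - \<gamma>' *\<^sub>R u')) \<bullet> (u - u')" and pos: "\<gamma> > 0" "\<gamma>' > 0"
  shows "norm (\<gamma> *\<^sub>R u - \<gamma>' *\<^sub>R u')
    \<le> 2 * (norm (\<xi> - \<xi>') + \<bar>1 - \<gamma> / \<gamma>'\<bar> * norm (\<gamma>' *\<^sub>R u'))"
proof -
  define w where "w = \<gamma> *\<^sub>R u - \<gamma>' *\<^sub>R u'"
  define c where "c = (1 - \<gamma> / \<gamma>') *\<^sub>R (\<gamma>' *\<^sub>R u')"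
  define g where "g = \<xi> - \<xi>'"
  have "\<gamma> *\<^sub>R (u - u') = w + c" using pos by (simp add: w_def c_def algebra_simps)
  moreover have "(\<xi> - \<gamma> *\<^sub>R u) - (\<xi>' - \<gamma>' *\<^sub>R u') = g - w" by (simp add: w_def g_def)
  ultimately have "0 \<le> (g - w) \<bullet> (w + c)"
    using mult_nonneg_nonneg[OF less_imp_le[OF pos(1)] mono] by (metis inner_scaleR_right)
  then have "norm w * norm w \<le> g \<bullet> w + g \<bullet> c - w \<bullet> c"
    by (simp add: inner_simps power2_norm_eq_inner[symmetric] power2_eq_square[symmetric])
  also have "\<dots> \<le> norm g * norm w + norm g * norm c + norm w * norm c"
    using Cauchy_Schwarz_ineq2[of g w] Cauchy_Schwarz_ineq2[of g c] Cauchy_Schwarz_ineq2[of w c] by linarith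
  finally have *: "norm w * norm w \<le> norm g * norm w + norm g * norm c + norm w * norm c" .
  \<comment> \<open>Completing the square: with \<open>t = \<parallel>g\<parallel> + \<parallel>c\<parallel>\<close>, the inequality \<open>*\<close> bounds \<open>\<parallel>w\<parallel>\<^sup>2 - t \<parallel>w\<parallel>\<close> by \<open>\<parallel>g\<parallel> \<parallel>c\<parallel>\<close>.\<close>
  define t where "t = norm g + norm c"
  have "norm g * norm c \<le> 2 * t\<^sup>2" by (simp add: t_def power2_sum)
  moreover have "(norm w - t / 2)\<^sup>2 = norm w * norm w - (norm g * norm w + norm w * norm c) + t\<^sup>2 / 4"
    by (simp add: t_def power2_eq_square field_simps)
  moreover have "(3 * t / 2)\<^sup>2 = t\<^sup>2 / 4 + 2 * t\<^sup>2"
    by (simp add: power2_eq_square)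
  ultimately have "(norm w - t / 2)\<^sup>2 \<le> (3 * t / 2)\<^sup>2"
    using * by argo
  then have "norm w - t / 2 \<le> 3 * t / 2"
    by (rule power2_le_imp_le) (simp add: t_def)
  then have "norm w \<le> 2 * (norm g + norm c)" unfolding t_def by argo
  then show ?thesis unfolding w_def c_def g_def norm_scaleR .
qed

section \<open>The perturbed inertial proximal iteration\<close>

text \<open>
  The resolvent step is rewritten as an implicit step along \<open>u k \<in> A (x (k + 1) - \<gamma> u k)\<close> with
  \<open>\<gamma> = b s k\<^sup>2\<close>.  So \<open>u k\<close> is the Yosida regularisation \<open>A\<^sub>\<gamma>\<close> at \<open>x (k + 1)\<close>, and
  \<open>x (k + 1) - \<gamma> u k\<close> is the value of the resolvent of \<open>A\<close> there.  All parameter conditions are gathered in the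
  single inequality on \<open>b\<close>, which makes the energy both coercive and decreasing.
\<close>

locale inertial_proximal =
  fixes A :: "'a::{real_inner, complete_space} \<Rightarrow> 'a set"
    and s \<alpha> b :: real
    and f x y u :: "nat \<Rightarrow> 'a"
  assumes A: "maximally_monotone A"
    and s: "s > 0" and \<alpha>: "\<alpha> > 2" and b: "2 + s \<le> b * \<alpha> * (\<alpha> - 2)"
    and f1: "summable (\<lambda>k. real k * norm (f k))"
    and f2: "summable (\<lambda>k. real k ^ 3 * (norm (f k))\<^sup>2)"
    and y: "k \<ge> 1 \<Longrightarrow> y k = x k + (1 - \<alpha> / real k) *\<^sub>R (x k - x (k - 1))"
    and x_Suc: "k \<ge> 1 \<Longrightarrow> x (k + 1) = y k + s *\<^sub>R f k - s *\<^sub>R u k"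
    and u: "k \<ge> 1 \<Longrightarrow> u k \<in> A (x (k + 1) - (b * s * (real k)\<^sup>2) *\<^sub>R u k)"
begin

lemma monotone: "v \<in> A p \<Longrightarrow> w \<in> A q \<Longrightarrow> 0 \<le> (p - q) \<bullet> (v - w)"
  using A unfolding maximally_monotone_iff monotone_operator_def by blast

lemma b_pos: "b > 0"
proof -
  have "0 < b * (\<alpha> * (\<alpha> - 2))" using b s by (simp add: mult.assoc)
  moreover have "0 < \<alpha> * (\<alpha> - 2)" using \<alpha> by simp
  ultimately show ?thesis by (rule zero_less_mult_pos2)
qed

lemma cocoercive:
  assumes z: "z \<in> zeros A" and k: "k \<ge> 1"
  shows "(b * s * (real k)\<^sup>2) * (norm (u k))\<^sup>2 \<le> u k \<bullet> (x (k + 1) - z)"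
proof -
  have "0 \<in> A z" using z by (simp add: zeros_def inverse_operator_def)
  then have "0 \<le> (x (k + 1) - (b * s * (real k)\<^sup>2) *\<^sub>R u k - z) \<bullet> (u k - 0)"
    by (rule monotone[OF u[OF k]])
  also have "\<dots> = u k \<bullet> (x (k + 1) - z) - (b * s * (real k)\<^sup>2) * (norm (u k))\<^sup>2"
    by (simp add: inner_diff_left inner_diff_right inner_commute power2_norm_eq_inner)
  finally show ?thesis by simp
qed

lemma extrapolation_bounds:
  assumes "real k \<ge> \<alpha>"
  shows "0 \<le> 1 - \<alpha> / real k" "1 - \<alpha> / real k \<le> 1" "k \<ge> 1"
proof -
  have "0 < real k" using assms \<alpha> by linarith
  then show "0 \<le> 1 - \<alpha> / real k" "1 - \<alpha> / real k \<le> 1" "k \<ge> 1"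
    using assms \<alpha> by (simp_all add: field_simps)
qed

text \<open>
  The first bound is expressed through the quantities of the energy at index \<open>k\<close>, the second one
  serves when the iterates are known to be bounded.
\<close>

lemma norm_extrapolated_le:
  assumes "real k \<ge> \<alpha>"
  shows "norm (y k - z) \<le> norm (x (k - 1) - z) + 2 * norm (x k - x (k - 1))"
    and "norm (y k - z) \<le> norm (x k - z) + norm (x k - x (k - 1))"
proof -
  let ?d = "x k - x (k - 1)"
  note a = extrapolation_bounds[OF assms]
  have n: "norm ((1 - \<alpha> / real k) *\<^sub>R ?d) \<le> norm ?d"
    using a by (simp add: mult_left_le_one_le)
  have yk: "y k - z = (x k - z) + (1 - \<alpha> / real k) *\<^sub>R ?d" using y[OF a(3)] by simp
  show le: "norm (y k - z) \<le> norm (x k - z) + norm ?d"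
    unfolding yk using n norm_triangle_le by (metis add_left_mono norm_triangle_ineq order_trans)
  have "norm (x k - z) \<le> norm (x (k - 1) - z) + norm ?d"
    using norm_triangle_ineq[of "x (k - 1) - z" ?d] by simp
  with le show "norm (y k - z) \<le> norm (x (k - 1) - z) + 2 * norm ?d" by linarith
qed

definition energy :: "'a \<Rightarrow> nat \<Rightarrow> real" where
  "energy z k = inertial_energy b \<alpha> z (real k - 1) (x (k - 1)) (x k)"

definition perturbation :: "nat \<Rightarrow> real" where
  "perturbation k = (2 * b * (real k) ^ 3 + real k / 2) * (norm (s *\<^sub>R f k))\<^sup>2"

lemma perturbation_nonneg: "0 \<le> perturbation k"
  using b_pos by (simp add: perturbation_def)

lemma summable_perturbation: "summable perturbation"
proof (rule summable_comparison_test'[where N = 0])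
  show "summable (\<lambda>k. (2 * b + 1 / 2) * s\<^sup>2 * (real k ^ 3 * (norm (f k))\<^sup>2))"
    by (rule summable_mult[OF f2])
  show "norm (perturbation k) \<le> (2 * b + 1 / 2) * s\<^sup>2 * (real k ^ 3 * (norm (f k))\<^sup>2)" for k
  proof -
    have "real k \<le> real k ^ 3"
      by (cases "k = 0") (auto intro!: self_le_power)
    then have "2 * b * real k ^ 3 + real k / 2 \<le> (2 * b + 1 / 2) * real k ^ 3"
      by (simp add: algebra_simps)
    then have "perturbation k \<le> (2 * b + 1 / 2) * real k ^ 3 * (norm (s *\<^sub>R f k))\<^sup>2"
      unfolding perturbation_def by (intro mult_right_mono) auto
    also have "\<dots> = (2 * b + 1 / 2) * s\<^sup>2 * (real k ^ 3 * (norm (f k))\<^sup>2)"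
      by (simp add: power_mult_distrib)
    finally show ?thesis using perturbation_nonneg[of k] by simp
  qed
qed

lemma energy_step:
  assumes z: "z \<in> zeros A" and k: "real k \<ge> \<alpha>"
  shows "energy z (k + 1) \<le> energy z k
     - (s / 2 * (real k * (norm (x k - x (k - 1)))\<^sup>2) + b / 3 * (real k ^ 3 * (norm (s *\<^sub>R u k))\<^sup>2))
     + s * (real k * norm (f k)) * norm (y k - z) + perturbation k"
proof -
  note k1 = extrapolation_bounds(3)[OF k]
  have "s * real k * (f k \<bullet> (y k - z)) \<le> s * real k * (norm (f k) * norm (y k - z))"
    using s by (intro mult_left_mono norm_cauchy_schwarz) auto
  then show ?thesis
    using inertial_energy_decrease[OF \<alpha> k s less_imp_le[OF b_pos] b y[OF k1] x_Suc[OF k1] cocoercive[OF z k1]]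
    unfolding energy_def perturbation_def by (simp add: algebra_simps)
qed

lemma energy_coercive:
  obtains c where "c > 0"
    and "\<And>z k. k \<ge> 1 \<Longrightarrow>
      c * ((norm (x (k - 1) - z))\<^sup>2 + (real k - 1)\<^sup>2 * (norm (x k - x (k - 1)))\<^sup>2) \<le> energy z k"
proof
  define c where "c = min ((\<alpha> - 1) / 4) (b * \<alpha> / 2 - 1 / (\<alpha> - 1))"
  have "2 < b * \<alpha> * (\<alpha> - 1)"
    using b s b_pos \<alpha> by (smt (verit) mult_left_mono mult_pos_pos)
  then have "0 < b * \<alpha> / 2 - 1 / (\<alpha> - 1)" using \<alpha> by (simp add: field_simps)
  then show "c > 0" using \<alpha> by (simp add: c_def)
  fix z :: 'a and k :: nat assume "k \<ge> 1"
  let ?X = "(norm (x (k - 1) - z))\<^sup>2" and ?D = "(real k - 1)\<^sup>2 * (norm (x k - x (k - 1)))\<^sup>2"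
  have "c * (?X + ?D) \<le> (\<alpha> - 1) / 4 * ?X + (b * \<alpha> / 2 - 1 / (\<alpha> - 1)) * ?D"
    unfolding distrib_left c_def
    by (intro add_mono mult_right_mono min.cobounded1 min.cobounded2) auto
  also have "\<dots> \<le> energy z k"
    unfolding energy_def by (rule inertial_energy_coercive) (use \<alpha> \<open>k \<ge> 1\<close> in auto)
  finally show "c * (?X + ?D) \<le> energy z k" .
qed

lemma tail_index: obtains N :: nat where "real N \<ge> \<alpha>" "N \<ge> 2"
proof
  show "real (max 2 (nat \<lceil>\<alpha>\<rceil>)) \<ge> \<alpha>" by linarith
qed simp

text \<open>
  From an index \<open>N \<ge> \<alpha>\<close> on, the perturbation \<open>s k \<parallel>f k\<parallel> \<parallel>y k - z\<parallel>\<close> is at most a summable multiple of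
  the energy plus a summable constant: by coercivity \<open>\<parallel>y k - z\<parallel>\<close> grows no faster than
  \<open>energy / c + 2\<close>.  The discrete Gronwall lemma then bounds the energy and sums its decrements.
\<close>

lemma energy_estimates:
  assumes z: "z \<in> zeros A"
  shows "\<exists>M. \<forall>k. norm (x k - z) \<le> M"
    and "\<exists>M. \<forall>k. real k * norm (x (k + 1) - x k) \<le> M"
    and "summable (\<lambda>k. real k * (norm (x k - x (k - 1)))\<^sup>2)"
    and "summable (\<lambda>k. real k ^ 3 * (norm (u k))\<^sup>2)"
proof -
  obtain N :: nat where N: "real N \<ge> \<alpha>" "N \<ge> 2" by (rule tail_index)
  obtain c where c: "c > 0" and coercive: "\<And>z k. k \<ge> 1 \<Longrightarrow>
      c * ((norm (x (k - 1) - z))\<^sup>2 + (real k - 1)\<^sup>2 * (norm (x k - x (k - 1)))\<^sup>2) \<le> energy z k"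
    by (rule energy_coercive) blast
  define g where "g k = s * (real k * norm (f k))" for k
  define r where "r k = s / 2 * (real k * (norm (x k - x (k - 1)))\<^sup>2)
      + b / 3 * (real k ^ 3 * (norm (s *\<^sub>R u k))\<^sup>2)" for k
  have g0: "g k \<ge> 0" for k using s by (simp add: g_def)
  have r0: "r k \<ge> 0" for k using s b_pos by (simp add: r_def)
  have sg: "summable g" unfolding g_def by (rule summable_mult[OF f1])
  have step: "energy z (Suc n + N) \<le> (1 + 1 / c * g (n + N)) * energy z (n + N)
      + (2 * g (n + N) + perturbation (n + N)) - r (n + N)" for n
  proof -
    let ?k = "n + N"
    let ?X = "norm (x (?k - 1) - z)" and ?D = "norm (x ?k - x (?k - 1))"
    have k: "real ?k \<ge> \<alpha>" using N by simp
    have "1 * ?D\<^sup>2 \<le> (real ?k - 1)\<^sup>2 * ?D\<^sup>2"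
      using N by (intro mult_right_mono) (auto intro!: one_le_power)
    then have "c * (?X\<^sup>2 + ?D\<^sup>2) \<le> c * (?X\<^sup>2 + (real ?k - 1)\<^sup>2 * ?D\<^sup>2)"
      using c by (intro mult_left_mono) auto
    also have "\<dots> \<le> energy z ?k" using coercive[of ?k z] N by simp
    finally have "?X\<^sup>2 + ?D\<^sup>2 \<le> 1 / c * energy z ?k" using c by (simp add: field_simps)
    moreover have "?X + 2 * ?D \<le> ?X\<^sup>2 + ?D\<^sup>2 + 2"
      using zero_le_power2[of "2 * ?X - 1"] zero_le_power2[of "?D - 1"]
      by (simp add: power2_eq_square algebra_simps)
    ultimately have "norm (y ?k - z) \<le> 1 / c * energy z ?k + 2"
      using norm_extrapolated_le(1)[OF k, of z] by linarith
    from mult_left_mono[OF this g0[of ?k]]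
    have "g ?k * norm (y ?k - z) \<le> 1 / c * g ?k * energy z ?k + 2 * g ?k"
      by (simp add: algebra_simps)
    then show ?thesis
      using energy_step[OF z k] unfolding g_def[symmetric] r_def[symmetric]
      by (simp add: algebra_simps)
  qed
  have e0: "0 \<le> energy z (n + N)" for n
  proof -
    have "0 \<le> c * ((norm (x (n + N - 1) - z))\<^sup>2 + (real (n + N) - 1)\<^sup>2 * (norm (x (n + N) - x (n + N - 1)))\<^sup>2)"
      using c by simp
    then show ?thesis using coercive[of "n + N" z] N by linarith
  qed
  have p: "summable (\<lambda>n. 1 / c * g (n + N))" "summable (\<lambda>n. 2 * g (n + N) + perturbation (n + N))"
    using sg summable_perturbation
    by (intro summable_mult summable_add; simp only: summable_iff_shift)+
  have pos: "0 \<le> 1 / c * g (n + N)" "0 \<le> 2 * g (n + N) + perturbation (n + N)" for n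
    using c g0 perturbation_nonneg by (auto intro: add_nonneg_nonneg)
  note gronwall = discrete_gronwall[OF step e0 pos(1) pos(2) r0 p(1) p(2)]
  obtain M where M: "\<And>n. energy z (n + N) \<le> M" using gronwall(1) by blast
  have both: "(norm (x (k - 1) - z))\<^sup>2 \<le> M / c"
    "((real k - 1) * norm (x k - x (k - 1)))\<^sup>2 \<le> M / c" if "k \<ge> N" for k
  proof -
    have "c * ((norm (x (k - 1) - z))\<^sup>2 + (real k - 1)\<^sup>2 * (norm (x k - x (k - 1)))\<^sup>2) \<le> M"
      using coercive[of k z] M[of "k - N"] that N by simp
    then have "(norm (x (k - 1) - z))\<^sup>2 + ((real k - 1) * norm (x k - x (k - 1)))\<^sup>2 \<le> M / c"
      unfolding power_mult_distrib using c by (simp add: pos_le_divide_eq mult.commute)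
    then show "(norm (x (k - 1) - z))\<^sup>2 \<le> M / c"
      "((real k - 1) * norm (x k - x (k - 1)))\<^sup>2 \<le> M / c"
      using zero_le_power2[of "norm (x (k - 1) - z)"]
        zero_le_power2[of "(real k - 1) * norm (x k - x (k - 1))"] by linarith+
  qed
  have tail_bound: "\<exists>M. \<forall>k. a k \<le> M" if a: "\<And>k. k \<ge> N \<Longrightarrow> (a k)\<^sup>2 \<le> M / c" for a :: "nat \<Rightarrow> real"
  proof -
    have "a k \<le> max (sqrt (M / c)) (Max (a ` {..N}))" for k
    proof (cases "k \<ge> N")
      case True
      then show ?thesis using real_le_rsqrt[OF a] by (simp add: le_max_iff_disj)
    next
      case False
      then have "a k \<le> Max (a ` {..N})" by (intro Max_ge) auto
      then show ?thesis by simp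
    qed
    then show ?thesis by blast
  qed
  show "\<exists>M. \<forall>k. norm (x k - z) \<le> M"
    by (rule tail_bound) (use both(1)[of "Suc _"] in simp)
  show "\<exists>M. \<forall>k. real k * norm (x (k + 1) - x k) \<le> M"
    by (rule tail_bound) (use both(2)[of "Suc _"] in simp)
  have sr: "summable r" using gronwall(2) by (simp only: summable_iff_shift)
  show "summable (\<lambda>k. real k * (norm (x k - x (k - 1)))\<^sup>2)"
  proof (rule summable_comparison_test'[where N = 0])
    show "summable (\<lambda>k. 2 / s * r k)" by (rule summable_mult[OF sr])
    fix k
    have "s / 2 * (real k * (norm (x k - x (k - 1)))\<^sup>2) \<le> r k" unfolding r_def using b_pos by simp
    then show "norm (real k * (norm (x k - x (k - 1)))\<^sup>2) \<le> 2 / s * r k"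
      using s by (simp add: field_simps)
  qed
  show "summable (\<lambda>k. real k ^ 3 * (norm (u k))\<^sup>2)"
  proof (rule summable_comparison_test'[where N = 0])
    show "summable (\<lambda>k. 3 / (b * s\<^sup>2) * r k)" by (rule summable_mult[OF sr])
    fix k
    have "b / 3 * (real k ^ 3 * (norm (s *\<^sub>R u k))\<^sup>2) \<le> r k" unfolding r_def using s by simp
    then have "b * s\<^sup>2 / 3 * (real k ^ 3 * (norm (u k))\<^sup>2) \<le> r k"
      by (simp add: power_mult_distrib algebra_simps)
    then show "norm (real k ^ 3 * (norm (u k))\<^sup>2) \<le> 3 / (b * s\<^sup>2) * r k"
      using s b_pos by (simp add: field_simps)
  qed
qed

text \<open>
  Without the cocoercivity gain, the step reads \<open>k \<theta> (k + 1) \<le> (k - \<alpha>) \<theta> k + q k\<close> for the positive part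
  \<open>\<theta>\<close> of the increments of \<open>\<parallel>x k - z\<parallel>\<^sup>2\<close>, with \<open>q\<close> summable by the energy estimates.  As
  \<open>k - \<alpha> = (k - 1) - (\<alpha> - 1)\<close> and \<open>\<alpha> > 1\<close>, the sequence \<open>(k - 1) \<theta> k\<close> decreases by \<open>(\<alpha> - 1) \<theta> k\<close> up to
  \<open>q\<close>, which makes \<open>\<theta>\<close> summable.
\<close>

lemma convergent_distance:
  assumes z: "z \<in> zeros A"
  shows "convergent (\<lambda>k. (norm (x k - z))\<^sup>2)"
proof -
  obtain N :: nat where N: "real N \<ge> \<alpha>" "N \<ge> 2" by (rule tail_index)
  obtain M where M: "\<And>k. norm (x k - z) \<le> M" using energy_estimates(1)[OF z] by blast
  then have M0: "M \<ge> 0" using norm_ge_zero order_trans by blast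
  define h where "h k = (norm (x k - z))\<^sup>2" for k
  define \<delta> where "\<delta> k = (norm (x k - x (k - 1)))\<^sup>2" for k
  define \<theta> where "\<theta> k = max 0 (h k - h (k - 1))" for k
  define q where "q k = 2 * (real k * \<delta> k) + 6 * s * M * (real k * norm (f k)) + 2 * perturbation k" for k
  have "summable q"
    unfolding q_def \<delta>_def
    by (intro summable_add summable_mult energy_estimates(3)[OF z] f1 summable_perturbation)
  have q0: "q k \<ge> 0" for k
    using M0 s perturbation_nonneg by (auto simp: q_def \<delta>_def intro!: add_nonneg_nonneg)
  have step: "real k * \<theta> (k + 1) \<le> (real k - \<alpha>) * \<theta> k + q k" if k: "real k \<ge> \<alpha>" for k
  proof -
    define a where "a = 1 - \<alpha> / real k"
    note ab = extrapolation_bounds[OF k, folded a_def]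
    have \<kappa>a: "real k * a = real k - \<alpha>" using ab(3) by (simp add: a_def field_simps)
    have "h (k + 1) \<le> h k + a * (h k - h (k - 1)) + a * (1 + a) * \<delta> k
        + 2 * s * (f k \<bullet> (y k - z)) + (norm (s *\<^sub>R f k))\<^sup>2
        - 2 * s * (b * s * (real k)\<^sup>2) * (norm (u k))\<^sup>2"
      using cocoercive_step[OF x_Suc[OF ab(3)] less_imp_le[OF s] cocoercive[OF z ab(3)]]
      unfolding y[OF ab(3)] a_def[symmetric] norm_extrapolation h_def \<delta>_def by simp
    moreover have "0 \<le> 2 * s * (b * s * (real k)\<^sup>2) * (norm (u k))\<^sup>2" using s b_pos by simp
    moreover have "a * (1 + a) * \<delta> k \<le> 2 * \<delta> k"
    proof -
      have "a * (1 + a) \<le> 1 * 2" using ab by (intro mult_mono) auto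
      then show ?thesis by (intro mult_right_mono) (auto simp: \<delta>_def)
    qed
    moreover have "2 * s * (f k \<bullet> (y k - z)) \<le> 6 * s * M * norm (f k)"
    proof -
      have "norm (x k - x (k - 1)) \<le> 2 * M"
        using norm_triangle_ineq4[of "x k - z" "x (k - 1) - z"] M[of k] M[of "k - 1"] by simp
      then have "norm (y k - z) \<le> 3 * M"
        using norm_extrapolated_le(2)[OF k, of z] M[of k] by linarith
      then have "norm (f k) * norm (y k - z) \<le> norm (f k) * (3 * M)" by (intro mult_left_mono) auto
      then have "f k \<bullet> (y k - z) \<le> norm (f k) * (3 * M)"
        using norm_cauchy_schwarz order_trans by blast
      then have "2 * s * (f k \<bullet> (y k - z)) \<le> 2 * s * (norm (f k) * (3 * M))"
        using s by (intro mult_left_mono) auto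
      then show ?thesis by (simp add: algebra_simps)
    qed
    moreover have "a * (h k - h (k - 1)) \<le> a * \<theta> k"
      using ab by (intro mult_left_mono) (auto simp: \<theta>_def)
    ultimately have "h (k + 1) - h k \<le> a * \<theta> k + (2 * \<delta> k + 6 * s * M * norm (f k) + (norm (s *\<^sub>R f k))\<^sup>2)"
      by linarith
    moreover have "0 \<le> a * \<theta> k + (2 * \<delta> k + 6 * s * M * norm (f k) + (norm (s *\<^sub>R f k))\<^sup>2)"
      using ab s M0 by (auto simp: \<theta>_def \<delta>_def intro!: add_nonneg_nonneg mult_nonneg_nonneg)
    ultimately have "\<theta> (k + 1) \<le> a * \<theta> k + (2 * \<delta> k + 6 * s * M * norm (f k) + (norm (s *\<^sub>R f k))\<^sup>2)"
      by (simp add: \<theta>_def)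
    from mult_left_mono[OF this, of "real k"]
    have "real k * \<theta> (k + 1) \<le> (real k * a) * \<theta> k + (2 * (real k * \<delta> k) + 6 * s * M * (real k * norm (f k)) + real k * (norm (s *\<^sub>R f k))\<^sup>2)"
      by (simp add: algebra_simps)
    moreover have "real k * (norm (s *\<^sub>R f k))\<^sup>2 \<le> 2 * perturbation k"
      using b_pos unfolding perturbation_def by (simp add: algebra_simps)
    ultimately show ?thesis unfolding \<kappa>a q_def by linarith
  qed
  have \<theta>0: "\<theta> k \<ge> 0" for k by (simp add: \<theta>_def)
  have "summable (\<lambda>n. (\<alpha> - 1) * \<theta> (n + N))"
  proof (rule discrete_gronwall(2)[where V = "\<lambda>n. (real (n + N) - 1) * \<theta> (n + N)" and p = "\<lambda>_. 0"
        and q = "\<lambda>n. q (n + N)"])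
    show "(real (Suc n + N) - 1) * \<theta> (Suc n + N)
        \<le> (1 + 0) * ((real (n + N) - 1) * \<theta> (n + N)) + q (n + N) - (\<alpha> - 1) * \<theta> (n + N)" for n
      using step[of "n + N"] N by (simp add: algebra_simps)
    show "0 \<le> (real (n + N) - 1) * \<theta> (n + N)" for n
      using N \<theta>0 by (intro mult_nonneg_nonneg) auto
    show "summable (\<lambda>n. q (n + N))" using \<open>summable q\<close> by (simp only: summable_iff_shift)
  qed (use q0 \<theta>0 \<alpha> in auto)
  then have "summable \<theta>"
    using \<alpha> by (simp only: summable_cmult_iff summable_iff_shift) auto
  then have "summable (\<lambda>n. \<theta> (Suc n))" by (simp only: summable_Suc_iff)
  then have "convergent h"
    by (intro convergent_of_summable_increments) (auto simp: h_def \<theta>_def)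
  then show ?thesis by (simp add: h_def[abs_def])
qed

text \<open>
  Let \<open>v k = b s k\<^sup>2 u k\<close>, the distance vector from \<open>x (k + 1)\<close> to its resolvent.  The energy
  estimates say that \<open>\<parallel>v k\<parallel>\<^sup>2 / k\<close> is summable, which alone does not give \<open>v k \<rightarrow> 0\<close>.  But \<open>v\<close> is bounded,
  and it changes by \<open>O(1 / k)\<close> per step: the iterates move by \<open>O(1 / k)\<close>, and so does the logarithm of
  the regularisation parameter.  Slow variation settles the matter.
\<close>

lemma yosida_tendsto_0:
  assumes z: "z \<in> zeros A"
  shows "(\<lambda>k. (b * s * (real k)\<^sup>2) *\<^sub>R u k) \<longlonglongrightarrow> 0"
proof -
  obtain M1 where M1: "\<And>k. norm (x k - z) \<le> M1" using energy_estimates(1)[OF z] by blast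
  obtain M2 where M2: "\<And>k. real k * norm (x (k + 1) - x k) \<le> M2" using energy_estimates(2)[OF z] by blast
  define v where "v k = (b * s * (real k)\<^sup>2) *\<^sub>R u k" for k
  have M1': "M1 \<ge> 0" using M1[of 0] norm_ge_zero order_trans by blast
  have M2': "M2 \<ge> 0" using M2[of 0] by simp
  have bs: "b * s > 0" using b_pos s by simp
  have v_le: "norm (v k) \<le> M1" if k: "k \<ge> 1" for k
  proof (cases "u k = 0")
    case False
    have "norm (v k) * norm (u k) = (b * s * (real k)\<^sup>2) * (norm (u k))\<^sup>2"
      using bs by (simp add: v_def power2_eq_square)
    also have "\<dots> \<le> norm (x (k + 1) - z) * norm (u k)"
      using cocoercive[OF z k] norm_cauchy_schwarz[of "u k" "x (k + 1) - z"] by (simp add: mult.commute)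
    finally have "norm (v k) \<le> norm (x (k + 1) - z)" using False by simp
    then show ?thesis using M1[of "k + 1"] by linarith
  qed (simp add: v_def M1')
  define B where "B = 2 * (M2 + 3 * M1)"
  have diff: "norm (v (Suc k) - v k) \<le> B / real k" if k: "k \<ge> 1" for k
  proof -
    have pos: "0 < b * s * (real (Suc k))\<^sup>2" "0 < b * s * (real k)\<^sup>2" using bs k by auto
    have "0 \<le> ((x (Suc k + 1) - (b * s * (real (Suc k))\<^sup>2) *\<^sub>R u (Suc k))
        - (x (k + 1) - (b * s * (real k)\<^sup>2) *\<^sub>R u k)) \<bullet> (u (Suc k) - u k)"
      using u[of "Suc k"] by (intro monotone u[OF k]) simp
    from yosida_difference[OF this pos]
    have "norm (v (Suc k) - v k) \<le> 2 * (norm (x (Suc k + 1) - x (k + 1))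
        + \<bar>1 - (b * s * (real (Suc k))\<^sup>2) / (b * s * (real k)\<^sup>2)\<bar> * norm (v k))"
      unfolding v_def .
    also have "\<dots> \<le> 2 * (M2 / real k + 3 / real k * M1)"
    proof (intro mult_left_mono add_mono mult_mono v_le k)
      have "real k * norm (x (Suc k + 1) - x (k + 1)) \<le> real (Suc k) * norm (x (Suc k + 1) - x (k + 1))"
        by (intro mult_right_mono) auto
      also have "\<dots> \<le> M2" using M2[of "Suc k"] by simp
      finally show "norm (x (Suc k + 1) - x (k + 1)) \<le> M2 / real k"
        using k by (simp add: field_simps)
      have "(b * s * (real (Suc k))\<^sup>2) / (b * s * (real k)\<^sup>2) = (real (Suc k))\<^sup>2 / (real k)\<^sup>2"
        using b_pos s by simp
      also have "\<dots> = 1 + (2 * real k + 1) / (real k)\<^sup>2"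
        using k by (simp add: field_simps power2_eq_square)
      finally have "\<bar>1 - (b * s * (real (Suc k))\<^sup>2) / (b * s * (real k)\<^sup>2)\<bar> = (2 * real k + 1) / (real k)\<^sup>2"
        by simp
      also have "\<dots> \<le> 3 / real k" using k by (simp add: field_simps power2_eq_square)
      finally show "\<bar>1 - (b * s * (real (Suc k))\<^sup>2) / (b * s * (real k)\<^sup>2)\<bar> \<le> 3 / real k" .
    qed auto
    also have "\<dots> = B / real k" by (simp add: B_def add_divide_distrib distrib_left)
    finally show ?thesis .
  qed
  have "(\<lambda>n. (norm (v (Suc n)))\<^sup>2) \<longlonglongrightarrow> 0"
  proof (rule slowly_varying_tendsto_0)
    show "\<bar>(norm (v (Suc (Suc n))))\<^sup>2 - (norm (v (Suc n)))\<^sup>2\<bar> \<le> (B * (2 * M1)) / real (Suc n)" for n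
    proof -
      have "\<bar>(norm (v (Suc (Suc n))))\<^sup>2 - (norm (v (Suc n)))\<^sup>2\<bar>
          = \<bar>norm (v (Suc (Suc n))) - norm (v (Suc n))\<bar> * \<bar>norm (v (Suc (Suc n))) + norm (v (Suc n))\<bar>"
        unfolding power2_eq_square square_diff_square_factored abs_mult by (rule mult.commute)
      also have "\<dots> \<le> B / real (Suc n) * (2 * M1)"
      proof (rule mult_mono)
        have "\<bar>norm (v (Suc (Suc n))) - norm (v (Suc n))\<bar> \<le> norm (v (Suc (Suc n)) - v (Suc n))"
          by (rule norm_triangle_ineq3)
        also have "\<dots> \<le> B / real (Suc n)" by (rule diff) simp
        finally show "\<bar>norm (v (Suc (Suc n))) - norm (v (Suc n))\<bar> \<le> B / real (Suc n)" .
        show "\<bar>norm (v (Suc (Suc n))) + norm (v (Suc n))\<bar> \<le> 2 * M1"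
          using v_le[of "Suc n"] v_le[of "Suc (Suc n)"] by simp
      qed (use M1' M2' in \<open>auto simp: B_def\<close>)
      finally show ?thesis by simp
    qed
    have "(norm (v k))\<^sup>2 / real k = (b * s)\<^sup>2 * (real k ^ 3 * (norm (u k))\<^sup>2)" for k
      using b_pos s by (cases "k = 0") (simp_all add: v_def power_mult_distrib abs_mult power2_eq_square power3_eq_cube)
    then have "summable (\<lambda>k. (norm (v k))\<^sup>2 / real k)"
      using summable_mult[OF energy_estimates(4)[OF z], of "(b * s)\<^sup>2"] by simp
    then show "summable (\<lambda>n. (norm (v (Suc n)))\<^sup>2 / real (Suc n))"
      by (subst summable_Suc_iff[where f = "\<lambda>k. (norm (v k))\<^sup>2 / real k"])
  qed simp
  then have "(\<lambda>n. sqrt ((norm (v (Suc n)))\<^sup>2)) \<longlonglongrightarrow> sqrt 0" by (rule tendsto_real_sqrt)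
  then have "(\<lambda>n. norm (v (Suc n))) \<longlonglongrightarrow> 0" by simp
  then have "(\<lambda>n. v (Suc n)) \<longlonglongrightarrow> 0" by (rule tendsto_norm_zero_cancel)
  then have "v \<longlonglongrightarrow> 0" by (rule LIMSEQ_imp_Suc)
  then show ?thesis by (simp add: v_def[abs_def])
qed

text \<open>
  Demiclosedness of the graph, transferred to hulls.  For \<open>q \<in> A p'\<close>, monotonicity at the resolvent
  points bounds \<open>x (k + 1) \<bullet> q\<close> by a sequence tending to \<open>p' \<bullet> q\<close>, because \<open>u\<close> and \<open>v\<close> tend to zero in
  norm.  This inequality is linear in the iterate, so it passes to the hull, and maximality gives
  \<open>0 \<in> A p\<close>.
\<close>

lemma asymptotic_hull_subset_zeros:
  assumes "zeros A \<noteq> {}" and r: "strict_mono r"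
  shows "asymptotic_hull (x \<circ> r) \<subseteq> zeros A"
proof
  fix p assume p: "p \<in> asymptotic_hull (x \<circ> r)"
  obtain z where z: "z \<in> zeros A" using assms by blast
  obtain M where M: "\<And>k. norm (x k - z) \<le> M" using energy_estimates(1)[OF z] by blast
  define v where "v k = (b * s * (real k)\<^sup>2) *\<^sub>R u k" for k
  have v: "v \<longlonglongrightarrow> 0" using yosida_tendsto_0[OF z] by (simp add: v_def[abs_def])
  have bs: "b * s > 0" using b_pos s by simp
  have u0: "u \<longlonglongrightarrow> 0"
  proof (rule tendsto_norm_zero_cancel, rule tendsto_sandwich[OF _ _ tendsto_const])
    show "\<forall>\<^sub>F k in sequentially. norm (u k) \<le> 1 / (b * s) * norm (v k)"
    proof (rule eventually_sequentiallyI)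
      fix k :: nat assume "1 \<le> k"
      then have "1 * norm (u k) \<le> (real k)\<^sup>2 * norm (u k)" by (intro mult_right_mono one_le_power) auto
      then show "norm (u k) \<le> 1 / (b * s) * norm (v k)" using b_pos s by (simp add: v_def abs_mult)
    qed
    show "(\<lambda>k. 1 / (b * s) * norm (v k)) \<longlonglongrightarrow> 0"
      using tendsto_mult_right_zero[OF tendsto_norm_zero[OF v]] .
  qed simp
  have "0 \<in> A p"
  proof -
    have "0 \<le> (p - p') \<bullet> (0 - q)" if q: "q \<in> A p'" for p' q
    proof -
      define g where "g k = (x (k + 1) - v k - p') \<bullet> u k + v k \<bullet> q + p' \<bullet> q" for k
      have le: "x (k + 1) \<bullet> q \<le> g k" if "k \<ge> 1" for k
      proof -
        have "0 \<le> (x (k + 1) - v k - p') \<bullet> (u k - q)"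
          unfolding v_def by (rule monotone[OF u[OF that] q])
        then show ?thesis by (simp add: g_def inner_diff_left inner_diff_right)
      qed
      have "(\<lambda>k. (x (k + 1) - v k - p') \<bullet> u k) \<longlonglongrightarrow> 0"
      proof (rule Lim_null_comparison)
        show "\<forall>\<^sub>F k in sequentially. norm ((x (k + 1) - v k - p') \<bullet> u k) \<le> (M + norm (z - p') + norm (v k)) * norm (u k)"
        proof (intro always_eventually allI)
          fix k
          have "norm (x (k + 1) - v k - p') \<le> norm (x (k + 1) - z) + norm (z - p') + norm (v k)"
            using norm_triangle_ineq4[of "(x (k + 1) - z) + (z - p')" "v k"]
              norm_triangle_ineq[of "x (k + 1) - z" "z - p'"] by (simp add: algebra_simps)
          then have "norm (x (k + 1) - v k - p') \<le> M + norm (z - p') + norm (v k)"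
            using M[of "k + 1"] by linarith
          then have "norm (x (k + 1) - v k - p') * norm (u k) \<le> (M + norm (z - p') + norm (v k)) * norm (u k)"
            by (rule mult_right_mono) simp
          then show "norm ((x (k + 1) - v k - p') \<bullet> u k) \<le> (M + norm (z - p') + norm (v k)) * norm (u k)"
            using Cauchy_Schwarz_ineq2[of "x (k + 1) - v k - p'" "u k"] by simp
        qed
        show "(\<lambda>k. (M + norm (z - p') + norm (v k)) * norm (u k)) \<longlonglongrightarrow> 0"
        proof -
          have "(\<lambda>k. (M + norm (z - p') + norm (v k)) * norm (u k))
              \<longlonglongrightarrow> (M + norm (z - p') + norm (0 :: 'a)) * norm (0 :: 'a)"
            by (intro tendsto_intros v u0)
          then show ?thesis by simp
        qed
      qed
      then have "g \<longlonglongrightarrow> 0 + 0 \<bullet> q + p' \<bullet> q"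
        unfolding g_def by (intro tendsto_intros v)
      then have "g \<longlonglongrightarrow> p' \<bullet> q" by simp
      then have "(\<lambda>k. g (k - 1)) \<longlonglongrightarrow> p' \<bullet> q" by - (rule LIMSEQ_imp_Suc, simp)
      from LIMSEQ_subseq_LIMSEQ[OF this r] have lim: "(\<lambda>k. g (r k - 1)) \<longlonglongrightarrow> p' \<bullet> q"
        by (simp add: o_def)
      have "\<forall>\<^sub>F k in sequentially. (x \<circ> r) k \<bullet> q \<le> g (r k - 1)"
      proof (rule eventually_sequentiallyI)
        fix k :: nat assume "2 \<le> k"
        then have "r k \<ge> 2" using seq_suble[OF r, of k] by simp
        then show "(x \<circ> r) k \<bullet> q \<le> g (r k - 1)" using le[of "r k - 1"] by simp
      qed
      from asymptotic_hull_inner_le[OF p this lim] show ?thesis by (simp add: inner_diff_left)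
    qed
    then show ?thesis using A unfolding maximally_monotone_iff by blast
  qed
  then show "p \<in> zeros A" by (simp add: zeros_def inverse_operator_def)
qed

lemma weak_convergence:
  assumes "zeros A \<noteq> {}"
  shows "\<exists>p\<in>zeros A. weakly_converges x p"
proof (rule opial)
  obtain z where z: "z \<in> zeros A" using assms by blast
  obtain M where M: "\<And>k. norm (x k - z) \<le> M" using energy_estimates(1)[OF z] by blast
  then have "range x \<subseteq> cball z M" by (auto simp: dist_norm norm_minus_commute)
  then show "bounded (range x)" using bounded_cball bounded_subset by blast
qed (use convergent_distance asymptotic_hull_subset_zeros[OF assms] in auto)

lemma velocity_le:
  assumes "zeros A \<noteq> {}"
  obtains M where "\<forall>\<^sub>F k in sequentially. norm (x (k + 1) - x k) \<le> M * (1 / real k)"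
proof -
  obtain z where z: "z \<in> zeros A" using assms by blast
  obtain M where M: "\<And>k. real k * norm (x (k + 1) - x k) \<le> M" using energy_estimates(2)[OF z] by blast
  have "\<forall>\<^sub>F k in sequentially. norm (x (k + 1) - x k) \<le> M * (1 / real k)"
  proof (rule eventually_sequentiallyI)
    fix k :: nat assume "1 \<le> k"
    then show "norm (x (k + 1) - x k) \<le> M * (1 / real k)"
      using M[of k] by (simp add: field_simps)
  qed
  then show thesis by (rule that)
qed

lemma velocity_bigo:
  assumes "zeros A \<noteq> {}"
  shows "(\<lambda>k. norm (x (k + 1) - x k)) \<in> O(\<lambda>k. 1 / real k)"
proof -
  obtain M where "\<forall>\<^sub>F k in sequentially. norm (x (k + 1) - x k) \<le> M * (1 / real k)"
    by (rule velocity_le[OF assms])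
  then show ?thesis by (intro bigoI[where c = M]) simp
qed

lemma velocity_tendsto_0:
  assumes "zeros A \<noteq> {}"
  shows "(\<lambda>k. x (k + 1) - x k) \<longlonglongrightarrow> 0"
proof -
  obtain M where M: "\<forall>\<^sub>F k in sequentially. norm (x (k + 1) - x k) \<le> M * (1 / real k)"
    by (rule velocity_le[OF assms])
  show ?thesis
    by (rule Lim_null_comparison[OF M tendsto_mult_right_zero[OF lim_1_over_n]])
qed

lemma weakly_converges_extrapolated:
  assumes "zeros A \<noteq> {}" and "weakly_converges x p"
  shows "weakly_converges y p"
  unfolding weakly_converges_def
proof
  fix w
  have d: "(\<lambda>k. x (Suc k) - x k) \<longlonglongrightarrow> 0" using velocity_tendsto_0[OF assms(1)] by simp
  have "(\<lambda>k. x k \<bullet> w) \<longlonglongrightarrow> p \<bullet> w" using assms(2) by (simp add: weakly_converges_def)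
  then have xS: "(\<lambda>k. x (Suc k) \<bullet> w) \<longlonglongrightarrow> p \<bullet> w" by (rule LIMSEQ_Suc)
  have "(\<lambda>k. \<alpha> * inverse (real (Suc k))) \<longlonglongrightarrow> \<alpha> * 0"
    by (intro tendsto_intros LIMSEQ_inverse_real_of_nat)
  then have a: "(\<lambda>k. \<alpha> / real (Suc k)) \<longlonglongrightarrow> 0" by (simp add: divide_inverse)
  have "(\<lambda>k. x (Suc k) \<bullet> w + (1 - \<alpha> / real (Suc k)) * ((x (Suc k) - x k) \<bullet> w))
      \<longlonglongrightarrow> p \<bullet> w + (1 - 0) * (0 \<bullet> w)"
    by (intro tendsto_intros xS a d)
  moreover have "x (Suc k) \<bullet> w + (1 - \<alpha> / real (Suc k)) * ((x (Suc k) - x k) \<bullet> w) = y (Suc k) \<bullet> w" for k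
    using y[of "Suc k"] by (simp add: inner_add_left)
  ultimately have "(\<lambda>k. y (Suc k) \<bullet> w) \<longlonglongrightarrow> p \<bullet> w" by simp
  then show "(\<lambda>k. y k \<bullet> w) \<longlonglongrightarrow> p \<bullet> w" by (rule LIMSEQ_imp_Suc)
qed

end

section \<open>Convergence of the algorithm\<close>

theorem theorem4p2:
  fixes A :: "'a::{real_inner, complete_space} \<Rightarrow> 'a set"
    and s \<alpha> \<epsilon> :: real
    and lam :: "nat \<Rightarrow> real"
    and f x y :: "nat \<Rightarrow> 'a"
  assumes "maximally_monotone A"
    and "zeros A \<noteq> {}"
    and "s > 0"
    and "\<alpha> > 2"
    and "\<epsilon> > (2 + s) / (\<alpha> - 2)"
    and "\<And>k. k \<ge> 1 \<Longrightarrow> lam k = (1 + s / 2 + \<epsilon>) * (2 * s / \<alpha>\<^sup>2) * (real k)\<^sup>2"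
    and "summable (\<lambda>k. real k * norm (f k))"
    and "summable (\<lambda>k. (real k) ^ 3 * (norm (f k))\<^sup>2)"
    and "\<And>k. k \<ge> 1 \<Longrightarrow> y k = x k + (1 - \<alpha> / real k) *\<^sub>R (x k - x (k - 1))"
    and "\<And>k. k \<ge> 1 \<Longrightarrow>
           x (k + 1) = (lam k / (lam k + s)) *\<^sub>R (y k + s *\<^sub>R f k)
                     + (s / (lam k + s)) *\<^sub>R resolvent (lam k + s) A (y k + s *\<^sub>R f k)"
  shows "(\<lambda>k. norm (x (k + 1) - x k)) \<longlonglongrightarrow> 0
       \<and> (\<lambda>k. norm (x (k + 1) - x k)) \<in> O(\<lambda>k. 1 / real k)
       \<and> summable (\<lambda>k. real k * (norm (x k - x (k - 1)))\<^sup>2)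
       \<and> (\<exists>xhat \<in> zeros A. weakly_converges x xhat \<and> weakly_converges y xhat)"
proof -
  \<comment> \<open>The factor for which the prescribed parameters are \<open>lam k = b * s * k\<^sup>2\<close>.\<close>
  define b where "b = 2 * (1 + s / 2 + \<epsilon>) / \<alpha>\<^sup>2"
  define w where "w k = y k + s *\<^sub>R f k" for k
  define J where "J k = resolvent (lam k + s) A (w k)" for k
  define u where "u k = (1 / (lam k + s)) *\<^sub>R (w k - J k)" for k
  have eps: "2 + s < \<epsilon> * (\<alpha> - 2)" using assms(4,5) by (simp add: pos_divide_less_eq)
  have "\<epsilon> > 0" using assms(3-5) by (smt (verit) divide_pos_pos)
  have lam: "lam k = b * s * (real k)\<^sup>2" if "k \<ge> 1" for k
    using assms(6)[OF that] by (simp add: b_def)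
  have "b > 0" using \<open>\<epsilon> > 0\<close> assms(3,4) by (simp add: b_def)
  interpret inertial_proximal A s \<alpha> b f x y u
  proof
    \<comment> \<open>After multiplication by \<open>\<alpha>\<close>, the parameter condition of the locale
    follows from the lower bound on \<open>\<epsilon>\<close>.\<close>
    have "(2 + s) * \<alpha> \<le> (2 + s + 2 * \<epsilon>) * (\<alpha> - 2)"
      using eps by (simp add: algebra_simps)
    moreover have "b * \<alpha> * (\<alpha> - 2) = (2 + s + 2 * \<epsilon>) * (\<alpha> - 2) / \<alpha>"
      using assms(4) by (simp add: b_def power2_eq_square field_simps)
    ultimately show "2 + s \<le> b * \<alpha> * (\<alpha> - 2)"
      using assms(4) by (simp add: pos_le_divide_eq)
    fix k :: nat assume k: "k \<ge> 1"
    show "y k = x k + (1 - \<alpha> / real k) *\<^sub>R (x k - x (k - 1))" by (rule assms(9)[OF k])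
    have pos: "lam k + s > 0" "lam k + s \<noteq> 0"
      using lam[OF k] \<open>b > 0\<close> assms(3) by (simp_all add: add_nonneg_pos add_nonneg_eq_0_iff)
    have J: "J k = w k - (lam k + s) *\<^sub>R u k" using pos by (simp add: u_def)
    have x: "x (k + 1) = (lam k / (lam k + s)) *\<^sub>R w k + (s / (lam k + s)) *\<^sub>R J k"
      unfolding w_def J_def by (rule assms(10)[OF k])
    have "(s / (lam k + s)) *\<^sub>R (lam k + s) *\<^sub>R u k = s *\<^sub>R u k" using pos by simp
    then have "x (k + 1) = (lam k / (lam k + s) + s / (lam k + s)) *\<^sub>R w k - s *\<^sub>R u k"
      by (simp only: x J scaleR_left_distrib scaleR_diff_right add_diff_eq)
    also have "lam k / (lam k + s) + s / (lam k + s) = 1"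
      using pos by (simp add: add_divide_distrib[symmetric])
    finally have x': "x (k + 1) = w k - s *\<^sub>R u k" by simp
    then show "x (k + 1) = y k + s *\<^sub>R f k - s *\<^sub>R u k" by (simp add: w_def)
    have "x (k + 1) - lam k *\<^sub>R u k = J k" unfolding x' J by (simp add: algebra_simps)
    moreover have "u k \<in> A (J k)"
      unfolding u_def J_def by (rule resolvent_inclusion[OF assms(1) pos(1)])
    ultimately show "u k \<in> A (x (k + 1) - (b * s * (real k)\<^sup>2) *\<^sub>R u k)" using lam[OF k] by simp
  qed (fact assms)+
  obtain z where z: "z \<in> zeros A" using assms(2) by blast
  obtain p where "p \<in> zeros A" "weakly_converges x p" using weak_convergence[OF assms(2)] by blast
  then show ?thesis
    using tendsto_norm_zero[OF velocity_tendsto_0[OF assms(2)]] velocity_bigo[OF assms(2)]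
      energy_estimates(3)[OF z] weakly_converges_extrapolated[OF assms(2)] by blast
qed

end
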